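(* Let $N\in\{2,3,5,7,11,23\}$. The (primitive) simple roots of the lattice $L=\Lambda^\sigma\oplus II_{1,1}$, and thus the (primitive) real simple roots of the generalized Kac-Moody algebra $\mathcal G_N$, are the following: $$\Bigl(\lambda,1,\frac{\lambda^2}{2}-1\Bigr)\quad\text{for } \lambda\in\Lambda^\sigma,$$ and $$\Bigl(\lambda,N,\frac{\lambda^2}{2N}-1\Bigr)\quad\text{for }\lambda\in N{\Lambda^\sigma}^*\text{ such that } N\ \Big|\ \Bigl(\frac{\lambda^2}{2N}-1\Bigr).$$ The former simple roots have height $1$ and norm $2$, whereas the latter have height $N$ and norm $2N$.
   Context: Let $M=24/(N+1)$. $\Lambda$ is the Leech lattice (positive definite, even, unimodular, rank 24, no vectors of norm 2; the norm of $v$ is $v^2=(v,v)$). $\sigma$ is an automorphism of $\Lambda$ of order $N$ and cycle shape $1^MN^M$ (characteristic polynomial $(x-1)^M(x^N-1)^M$), $\Lambda^\sigma$ is its fixed sublattice, with dual ${\Lambda^\sigma}^*$; $II_{1,1}=\mathbb Z^2$ with $(m,n)$ of norm $-2mn$, and $L=\Lambda^\sigma\oplus II_{1,1}$ has elements $(\lambda,m,n)$ of norm $\lambda^2-2mn$. Let $\rho=(0,0,1)\in L$. A root of $L$ is a vector $r\in L$ of positive norm, primitive in the sense that $r/n\notin L$ for every integer $n$ with $|n|>1$, whose reflection $v\mapsto v-\frac{2(r,v)}{(r,r)}r$ preserves $L$. The simple roots of $L$ are the simple roots of the reflection group of $L$ (the group generated by all these reflections) with respect to the Weyl chamber having $\rho$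 as Weyl vector; equivalently they are the primitive roots $r$ with $(r,\rho)=-r^2/2$. The height of $r$ is $-(\rho,r)$. $\mathcal G_N$ is the generalized Kac-Moody algebra whose real simple roots are, by construction, the simple roots of the reflection group of $L$, and whose imaginary simple roots are the vectors $n\rho$, $n\ge1$, with multiplicity $M$ if $N\nmid n$ and $2M$ if $N\mid n$. *)

theory Defs
  imports "HOL-Analysis.Analysis" "HOL-Computational_Algebra.Polynomial"
begin

section \<open>Lattices in Euclidean space\<close>

definition full_lattice :: "'a::euclidean_space set \<Rightarrow> bool" where
  "full_lattice \<Lambda> \<longleftrightarrow>
     (\<exists>B. independent B \<and> span B = UNIV \<and>
          \<Lambda> = {(\<Sum>b\<in>B. of_int (c b) *\<^sub>R b) | c :: 'a \<Rightarrow> int. True})"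

text \<open>The dual is taken inside the real span, so that it is also meaningful for
  lattices of smaller rank than the ambient space.\<close>
definition lattice_dual :: "'a::euclidean_space set \<Rightarrow> 'a set" where
  "lattice_dual S = {v \<in> span S. \<forall>w\<in>S. v \<bullet> w \<in> \<int>}"

text \<open>By the classical uniqueness theorem these properties determine the Leech lattice
  up to isometry.\<close>
definition leech_lattice :: "(real^24) set \<Rightarrow> bool" where
  "leech_lattice \<Lambda> \<longleftrightarrow>
     full_lattice \<Lambda> \<and>
     lattice_dual \<Lambda> = \<Lambda> \<and>
     (\<forall>v\<in>\<Lambda>. \<exists>k::int. v \<bullet> v = 2 * of_int k) \<and>
     (\<forall>v\<in>\<Lambda>. v \<bullet> v \<noteq> 2)"

text \<open>An automorphism of a full lattice extends uniquely to a linear isometry of the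
  ambient space, and is represented by this extension.\<close>
definition lattice_automorphism :: "'a::euclidean_space set \<Rightarrow> ('a \<Rightarrow> 'a) \<Rightarrow> bool" where
  "lattice_automorphism \<Lambda> \<sigma> \<longleftrightarrow> orthogonal_transformation \<sigma> \<and> \<sigma> ` \<Lambda> = \<Lambda>"

definition has_order :: "('a \<Rightarrow> 'a) \<Rightarrow> nat \<Rightarrow> bool" where
  "has_order \<sigma> N \<longleftrightarrow>
     0 < N \<and> (\<sigma> ^^ N) = id \<and> (\<forall>k. 0 < k \<and> k < N \<longrightarrow> (\<sigma> ^^ k) \<noteq> id)"

definition charpoly :: "real^'n^'n \<Rightarrow> real poly" where
  "charpoly A = det (\<chi> i j. (if i = j then [:0, 1:] else 0) - [:A $ i $ j:])"

definition has_cycle_shape_1_N :: "(real^'n \<Rightarrow> real^'n) \<Rightarrow> nat \<Rightarrow> nat \<Rightarrow> bool" where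
  "has_cycle_shape_1_N \<sigma> N M \<longleftrightarrow>
     charpoly (matrix \<sigma>) = ([:0, 1:] - 1) ^ M * ([:0, 1:] ^ N - 1) ^ M"

definition fixed_sublattice :: "('a \<Rightarrow> 'a) \<Rightarrow> 'a set \<Rightarrow> 'a set" where
  "fixed_sublattice \<sigma> \<Lambda> = {v \<in> \<Lambda>. \<sigma> v = v}"


section \<open>The Lorentzian lattice and its roots\<close>

type_synonym lvec = "(real^24) \<times> real \<times> real"

definition lform :: "lvec \<Rightarrow> lvec \<Rightarrow> real" where
  "lform = (\<lambda>(x, m, n) (y, m', n'). x \<bullet> y - m * n' - n * m')"

definition lorentz_lattice :: "(real^24) set \<Rightarrow> lvec set" where
  "lorentz_lattice S = S \<times> \<int> \<times> \<int>"

definition weyl_rho :: lvec where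
  "weyl_rho = (0, 0, 1)"

definition reflection :: "lvec \<Rightarrow> lvec \<Rightarrow> lvec" where
  "reflection r v = v - (2 * lform r v / lform r r) *\<^sub>R r"

definition is_root :: "lvec set \<Rightarrow> lvec \<Rightarrow> bool" where
  "is_root L r \<longleftrightarrow>
     r \<in> L \<and> lform r r > 0 \<and>
     (\<forall>n::int. \<bar>n\<bar> > 1 \<longrightarrow> (1 / of_int n) *\<^sub>R r \<notin> L) \<and>
     reflection r ` L = L"

definition height :: "lvec \<Rightarrow> real" where
  "height r = - lform weyl_rho r"


section \<open>Weyl chambers\<close>

text \<open>The reflection group acts on the two cones of negative norm vectors of the
  Lorentzian space \<open>span L\<close>. Its Weyl chambers are the (open) components left after
  removing all mirrors.\<close>
definition weyl_chamber :: "lvec set \<Rightarrow> lvec set \<Rightarrow> bool" where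
  "weyl_chamber L C \<longleftrightarrow>
     C \<in> components {v \<in> span L. lform v v < 0 \<and> (\<forall>r. is_root L r \<longrightarrow> lform r v \<noteq> 0)}"

text \<open>Sign convention: simple roots have inner product at most 0 with the chamber,
  which is the convention under which a Weyl vector satisfies
  \<open>(r, \<rho>) = - r\<^sup>2 / 2\<close>.\<close>
definition simple_roots :: "lvec set \<Rightarrow> lvec set \<Rightarrow> lvec set" where
  "simple_roots L C =
     {r. is_root L r \<and> (\<forall>v\<in>C. lform r v \<le> 0) \<and>
         {v \<in> closure C. lform r v = 0} facet_of closure C}"

definition weyl_vector :: "lvec set \<Rightarrow> lvec set \<Rightarrow> lvec \<Rightarrow> bool" where
  "weyl_vector L C \<rho> \<longleftrightarrow> (\<forall>r \<in> simple_roots L C. lform r \<rho> = - lform r r / 2)"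


section \<open>The generalized Kac-Moody algebra\<close>

text \<open>A generalized Kac-Moody algebra is specified by its simple roots, taken with
  multiplicity, in a space with a symmetric bilinear form; the Gram matrix of the simple
  roots is its Borcherds-Cartan matrix. Real and imaginary simple roots are told apart by
  the sign of their norm.\<close>
record 'v gkm =
  gkm_form :: "'v \<Rightarrow> 'v \<Rightarrow> real"
  gkm_simple_mult :: "'v \<Rightarrow> nat"

definition real_simple_roots :: "'v gkm \<Rightarrow> 'v set" where
  "real_simple_roots G = {r. gkm_simple_mult G r > 0 \<and> gkm_form G r r > 0}"

definition gkm_G :: "nat \<Rightarrow> nat \<Rightarrow> lvec set \<Rightarrow> lvec set \<Rightarrow> lvec gkm" where
  "gkm_G N M L C =
     \<lparr> gkm_form = lform,
       gkm_simple_mult = (\<lambda>r.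
         (if r \<in> simple_roots L C then 1 else 0) +
         (\<Sum>n | n \<ge> 1 \<and> r = real n *\<^sub>R weyl_rho. if N dvd n then 2 * M else M)) \<rparr>"

end

theory Submission
  imports Defs "HOL-Computational_Algebra.Primes"
begin

text \<open>Write \<open>R\<close> for the set of roots \<open>r\<close> with \<open>(r, \<rho>) = - r\<^sup>2 / 2\<close>. Two facts about the fixed
  sublattice \<open>S\<close> carry the whole argument: it is even and nonzero, and \<open>N S\<^sup>* \<subseteq> S\<close>. The
  inclusion holds because for \<open>w \<in> S\<^sup>*\<close> and \<open>x \<in> \<Lambda>\<close> the number \<open>N (w, x)\<close> is the inner product
  of \<open>w\<close> with the orbit sum \<open>\<Sum>i<N. \<sigma>\<^sup>i x \<in> S\<close>, so that \<open>N w\<close> lies in the dual of \<open>\<Lambda>\<close>, which is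
  \<open>\<Lambda>\<close> itself.

  \<^bold>\<open>The set R.\<close> If \<open>r\<close> is a root with \<open>r\<^sup>2 = 2 k\<close>, then \<open>r / k\<close> lies in the dual of \<open>L\<close>, hence
  \<open>(N / k) r \<in> L\<close>, and primitivity forces \<open>k\<close> to divide \<open>N\<close>; so \<open>k\<close> is \<open>1\<close> or \<open>N\<close>
  (\<open>is_root_iff\<close>). The equation \<open>(r, \<rho>) = - r\<^sup>2 / 2\<close> then fixes the second coordinate of \<open>r\<close>
  to be \<open>k\<close>, the norm determines the third, and these are the two families
  (\<open>weyl_roots_eq\<close>).

  \<^bold>\<open>Simple roots.\<close> Let \<open>C\<close> be a Weyl chamber with Weyl vector \<open>\<rho>\<close>. Its simple roots lie in
  \<open>R\<close>; the point is that every \<open>r \<in> R\<close> is simple. Since the mirrors are locally finite, \<open>C\<close> is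
  cut out of its half of the light cone by its simple roots
  (\<open>chamber_separated_by_simple_root\<close>), so it suffices to control the signs of elements of \<open>R\<close>.

  Suppose first that \<open>C\<close> is in the half that has \<open>\<rho>\<close> in its closure. All of \<open>R\<close> is negative on
  the horoball of vectors \<open>(x, 1, n)\<close> with \<open>n > 1 + x\<^sup>2 / 2\<close>, so \<open>C\<close> contains this horoball.
  A root orthogonal to \<open>\<rho>\<close> would have a mirror cutting the horoball, so there is none, and this
  makes the elements of \<open>R\<close> pairwise obtuse (\<open>weyl_roots_obtuse\<close>). Consequently the projection
  of a small ball in \<open>C\<close> onto the mirror of \<open>r \<in> R\<close> stays in the closure of \<open>C\<close>, and the mirror
  is a wall (\<open>future_chamber_weyl_root_simple\<close>).

  The other half of the light cone contains no such chamber (\<open>past_chamber_impossible\<close>). There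
  \<open>C\<close> would be stable under adding positive multiples of \<open>\<rho>\<close> until the light cone is reached, so
  it would contain every negative norm vector close to some null vector \<open>z\<close> proportional to a
  lattice vector. But powers of an Eichler transvection fixing \<open>z\<close> move a norm \<open>2\<close> vector to
  roots that converge to \<open>z\<close> in direction, and their mirrors cut every such neighbourhood.\<close>

section \<open>The Lorentzian form and its light cone\<close>

text \<open>Vectors of the Lorentzian space are treated as atoms; quantifiers over them must not be
  split into quantifiers over coordinates.\<close>
declare split_paired_All [simp del] split_paired_Ex [simp del]

lemma lform_Pair: "lform (x, m, n) (y, a, b) = x \<bullet> y - m * b - n * a"
  by (simp add: lform_def)

lemma lform_commute: "lform u v = lform v u"
  by (cases u; cases v) (simp add: lform_Pair inner_commute algebra_simps)

text \<open>The self-adjoint map that turns the Euclidean inner product into the Lorentzian one, so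
  that mirrors become hyperplanes in the sense of convex analysis.\<close>
definition flip :: "lvec \<Rightarrow> lvec" where
  "flip v = (fst v, - snd (snd v), - fst (snd v))"

lemma linear_flip: "linear flip"
  by (rule linearI) (auto simp: flip_def)

lemma lform_eq_inner: "lform u v = flip u \<bullet> v"
  by (cases u; cases v) (simp add: lform_Pair flip_def)

interpretation lform: bounded_bilinear lform
proof -
  have "bounded_bilinear (\<lambda>u. (\<bullet>) (flip u))"
    by (rule bounded_bilinear.comp1[OF bounded_bilinear_inner])
       (simp add: linear_flip linear_linear)
  then show "bounded_bilinear lform"
    by (simp add: lform_eq_inner[abs_def])
qed

lemmas lform_simps = lform.add_left lform.add_right lform.diff_left lform.diff_right
  lform.scaleR_left lform.scaleR_right lform.minus_left lform.minus_right

lemma lform_rho_Pair: "lform (x, m, n) weyl_rho = - m"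
  by (simp add: weyl_rho_def lform_Pair)

lemma lform_rho_rho: "lform weyl_rho weyl_rho = 0"
  by (simp add: weyl_rho_def lform_Pair)

lemma timelike_rho_nonzero:
  assumes "lform v v < 0" shows "lform v weyl_rho \<noteq> 0"
proof (cases v)
  case (fields x m n)
  have "0 \<le> x \<bullet> x" by simp
  with assms show ?thesis by (auto simp: fields lform_rho_Pair lform_Pair simp del: inner_ge_zero)
qed

text \<open>The reversed Cauchy-Schwarz inequality: the product of a vector of negative norm and one of
  nonpositive norm that is no multiple of \<open>\<rho>\<close> is negative exactly if both lie in the same half of
  the light cone. The half is read off from the sign of the product with \<open>\<rho>\<close>.\<close>
lemma timelike_causal_product:
  assumes v: "lform v v < 0" and w: "lform w w \<le> 0" and "lform w weyl_rho \<noteq> 0"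
  shows "lform v weyl_rho * lform w weyl_rho * lform v w < 0"
proof -
  obtain x m n where v_eq: "v = (x, m, n)" by (cases v)
  obtain y a b where w_eq: "w = (y, a, b)" by (cases w)
  have m: "m \<noteq> 0" using timelike_rho_nonzero[OF v] by (simp add: v_eq lform_rho_Pair)
  have a: "a \<noteq> 0" using assms(3) by (simp add: w_eq lform_rho_Pair)
  have "0 \<le> (a *\<^sub>R x - m *\<^sub>R y) \<bullet> (a *\<^sub>R x - m *\<^sub>R y)" by simp
  also have "\<dots> = a\<^sup>2 * (x \<bullet> x) + m\<^sup>2 * (y \<bullet> y) - 2 * a * m * (x \<bullet> y)"
    by (simp add: algebra_simps inner_commute power2_eq_square)
  finally have 1: "2 * a * m * (x \<bullet> y) \<le> a\<^sup>2 * (x \<bullet> x) + m\<^sup>2 * (y \<bullet> y)" by simp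
  have "a\<^sup>2 * (x \<bullet> x) < a\<^sup>2 * (2 * m * n)"
    using v a by (intro mult_strict_left_mono) (auto simp: v_eq lform_Pair)
  moreover have "m\<^sup>2 * (y \<bullet> y) \<le> m\<^sup>2 * (2 * a * b)"
    using w by (intro mult_left_mono) (auto simp: w_eq lform_Pair)
  ultimately have "2 * a * m * (x \<bullet> y) < a\<^sup>2 * (2 * m * n) + m\<^sup>2 * (2 * a * b)"
    using 1 by linarith
  then have "m * a * (x \<bullet> y - m * b - n * a) < 0"
    by (simp add: algebra_simps power2_eq_square)
  then show ?thesis by (simp add: v_eq w_eq lform_rho_Pair lform_Pair)
qed

text \<open>The form has only one negative square.\<close>
lemma orthogonal_to_timelike:
  assumes "lform p p < 0" and "lform u p = 0" and "u \<noteq> 0"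
  shows "lform u u > 0"
proof (rule ccontr)
  assume "\<not> ?thesis"
  then have u: "lform u u \<le> 0" by simp
  show False
  proof (cases "lform u weyl_rho = 0")
    case True
    obtain y a b where u_eq: "u = (y, a, b)" by (cases u)
    obtain x m n where p_eq: "p = (x, m, n)" by (cases p)
    have "a = 0" using True by (simp add: u_eq lform_rho_Pair)
    moreover from this have "y \<bullet> y \<le> 0" using u by (simp add: u_eq lform_Pair)
    then have "y = 0" using inner_ge_zero[of y] by (simp del: inner_ge_zero)
    moreover have "m \<noteq> 0"
      using timelike_rho_nonzero[OF assms(1)] by (simp add: p_eq lform_rho_Pair)
    ultimately show False using assms(2,3)
      by (auto simp: u_eq p_eq lform_Pair zero_prod_def)
  next
    case False
    from timelike_causal_product[OF assms(1) u False] assms(2) show False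
      by (simp add: lform_commute)
  qed
qed

text \<open>One of the two halves of the cone of negative norm vectors, selected by the sign of \<open>c\<close>:
  for \<open>c < 0\<close> it is the half whose closure contains \<open>\<rho>\<close>.\<close>
definition time_cone :: "real \<Rightarrow> lvec set" where
  "time_cone c = {v. lform v v < 0 \<and> c * lform v weyl_rho > 0}"

lemma time_cone_product:
  assumes "v \<in> time_cone c" and "lform w w \<le> 0" and "c * lform w weyl_rho > 0"
  shows "lform v w < 0"
proof -
  have "lform w weyl_rho \<noteq> 0" using assms(3) by auto
  with assms have *: "lform v weyl_rho * lform w weyl_rho * lform v w < 0"
    by (intro timelike_causal_product) (auto simp: time_cone_def)
  have "c * lform v weyl_rho > 0" using assms(1) by (simp add: time_cone_def)
  with assms(3) have "lform v weyl_rho * lform w weyl_rho > 0"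
    by (simp add: zero_less_mult_iff) argo
  with * show ?thesis by (metis mult_less_0_iff not_less_iff_gr_or_eq)
qed

lemma time_cone_scale:
  "v \<in> time_cone c \<Longrightarrow> t > 0 \<Longrightarrow> t *\<^sub>R v \<in> time_cone c"
  by (auto simp: time_cone_def lform_simps mult_less_0_iff zero_less_mult_iff)

lemma time_cone_add:
  assumes "v \<in> time_cone c" and "w \<in> time_cone c"
  shows "v + w \<in> time_cone c"
proof -
  have "lform v w < 0" using assms by (intro time_cone_product[OF assms(1)]) (auto simp: time_cone_def)
  then show ?thesis using assms
    by (auto simp: time_cone_def lform_simps lform_commute[of w v] algebra_simps)
qed

lemma convex_time_cone: "convex (time_cone c)"
proof (rule convexI)
  fix v w and s t :: real
  assume *: "v \<in> time_cone c" "w \<in> time_cone c" "0 \<le> s" "0 \<le> t" "s + t = 1"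
  show "s *\<^sub>R v + t *\<^sub>R w \<in> time_cone c"
  proof (cases "s = 0 \<or> t = 0")
    case True with * show ?thesis by auto
  next
    case False with * show ?thesis by (intro time_cone_add time_cone_scale) auto
  qed
qed

lemma open_time_cone: "open (time_cone c)"
  unfolding time_cone_def
  by (intro open_Collect_conj open_Collect_less continuous_intros lform.continuous_on)

section \<open>Weyl chambers as sign cells and their walls\<close>

definition chamber_cell :: "lvec set \<Rightarrow> lvec \<Rightarrow> lvec set" where
  "chamber_cell L v\<^sub>0 = {v \<in> span L. v \<in> time_cone (lform v\<^sub>0 weyl_rho) \<and>
     (\<forall>r. is_root L r \<longrightarrow> lform r v\<^sub>0 * lform r v > 0)}"

lemma convex_half: "convex {v. c * lform r v > 0}"
proof -
  have "{v. c * lform r v > 0} = {v. (c *\<^sub>R flip r) \<bullet> v > 0}" by (simp add: lform_eq_inner)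
  then show ?thesis by (simp only: convex_halfspace_gt)
qed

lemma convex_chamber_cell: "convex (chamber_cell L v\<^sub>0)"
proof -
  have "chamber_cell L v\<^sub>0 = span L \<inter> time_cone (lform v\<^sub>0 weyl_rho) \<inter>
          (\<Inter>r\<in>{r. is_root L r}. {v. lform r v\<^sub>0 * lform r v > 0})"
    by (auto simp: chamber_cell_def)
  then show ?thesis
    by (simp add: convex_Int convex_INT convex_half convex_time_cone subspace_imp_convex)
qed

lemma connected_nonzero_same_sign:
  fixes f :: "'a::topological_space \<Rightarrow> real"
  assumes "connected C" "continuous_on C f" "\<And>v. v \<in> C \<Longrightarrow> f v \<noteq> 0" "v \<in> C" "w \<in> C"
  shows "f v * f w > 0"
proof (rule ccontr)
  assume "\<not> ?thesis"
  then have "(f v \<le> 0 \<and> 0 \<le> f w) \<or> (f w \<le> 0 \<and> 0 \<le> f v)"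
    by (auto simp: zero_less_mult_iff not_less)
  moreover have "is_interval (f ` C)"
    using assms by (simp add: connected_continuous_image is_interval_connected_1)
  ultimately have "0 \<in> f ` C" using assms(4,5)
    unfolding is_interval_1 by blast
  then show False using assms(3) by auto
qed

text \<open>A connected set on which no root vanishes cannot change the sign of any root; conversely the
  sign cell is convex, hence connected, so the component fills it.\<close>
lemma weyl_chamber_eq_cell:
  assumes C: "weyl_chamber L C" and v\<^sub>0: "v\<^sub>0 \<in> C"
  shows "C = chamber_cell L v\<^sub>0"
proof
  let ?U = "{v \<in> span L. lform v v < 0 \<and> (\<forall>r. is_root L r \<longrightarrow> lform r v \<noteq> 0)}"
  have comp: "C \<in> components ?U" using C by (simp add: weyl_chamber_def)
  have conn: "connected C" and sub: "C \<subseteq> ?U"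
    using comp by (rule in_components_connected, rule in_components_subset)
  have cont: "continuous_on C (\<lambda>v. lform r v)" for r
    by (intro lform.continuous_on continuous_intros)
  show "C \<subseteq> chamber_cell L v\<^sub>0"
  proof
    fix v assume v: "v \<in> C"
    have "lform v\<^sub>0 weyl_rho * lform v weyl_rho > 0"
      using conn v\<^sub>0 v sub timelike_rho_nonzero
      by (intro connected_nonzero_same_sign[of C "\<lambda>v. lform v weyl_rho"])
         (auto intro!: lform.continuous_on continuous_intros)
    moreover have "lform r v\<^sub>0 * lform r v > 0" if "is_root L r" for r
      using conn v\<^sub>0 v sub that
      by (intro connected_nonzero_same_sign[of C "\<lambda>v. lform r v"] cont) auto
    ultimately show "v \<in> chamber_cell L v\<^sub>0"
      using sub v by (auto simp: chamber_cell_def time_cone_def)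
  qed
  have "v\<^sub>0 \<in> chamber_cell L v\<^sub>0"
    using \<open>C \<subseteq> chamber_cell L v\<^sub>0\<close> v\<^sub>0 by blast
  moreover have "chamber_cell L v\<^sub>0 \<subseteq> ?U"
    by (auto simp: chamber_cell_def time_cone_def)
  moreover have "connected (chamber_cell L v\<^sub>0)"
    by (simp add: convex_chamber_cell convex_connected)
  ultimately show "chamber_cell L v\<^sub>0 \<subseteq> C"
    using components_maximal[OF comp] v\<^sub>0 by blast
qed

lemma chamber_cell_scale:
  assumes "v \<in> chamber_cell L v\<^sub>0" "t > 0" shows "t *\<^sub>R v \<in> chamber_cell L v\<^sub>0"
proof -
  have "lform r v\<^sub>0 * (t * lform r v) > 0" if "lform r v\<^sub>0 * lform r v > 0" for r
    using mult_pos_pos[OF assms(2) that] by (simp add: ac_simps)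
  then show ?thesis
    using assms by (auto simp: chamber_cell_def time_cone_scale span_mul lform_simps)
qed

text \<open>A criterion for the facet condition that avoids describing the whole face: it is enough that
  the closure of the chamber contains a relatively open piece of the mirror, since then the face
  has the dimension of the mirror.\<close>
lemma simple_root_if_wall:
  assumes r: "is_root L r" and C: "C \<subseteq> span L" "convex C"
    and neg: "\<And>v. v \<in> C \<Longrightarrow> lform r v < 0"
    and v\<^sub>0: "v\<^sub>0 \<in> C" "d > 0" "ball v\<^sub>0 d \<inter> span L \<subseteq> C"
    and q: "q \<in> span L" "lform r q = 0" "e > 0"
      "\<And>u. u \<in> ball q e \<Longrightarrow> u \<in> span L \<Longrightarrow> lform r u = 0 \<Longrightarrow> u \<in> closure C"
  shows "r \<in> simple_roots L C"
proof -
  let ?V = "span L" and ?H = "{v. flip r \<bullet> v = 0}"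
  let ?F = "{v \<in> closure C. lform r v = 0}"
  have cl: "lform r v \<le> 0" if "v \<in> closure C" for v
  proof -
    have "closure C \<subseteq> {v. lform r v \<le> 0}"
      using neg by (intro closure_minimal closed_Collect_le continuous_intros lform.continuous_on)
        (auto intro: less_imp_le)
    with that show ?thesis by auto
  qed
  have clV: "closure C \<subseteq> ?V" by (rule closure_minimal[OF C(1) closed_span])
  have F_eq: "?F = closure C \<inter> ?H" by (auto simp: lform_eq_inner)
  have face: "?F face_of closure C"
    unfolding F_eq using cl C(2)
    by (intro face_of_Int_supporting_hyperplane_le) (auto simp: lform_eq_inner)
  have "aff_dim (closure C) = aff_dim ?V"
  proof (rule antisym)
    have "aff_dim (ball v\<^sub>0 d \<inter> ?V) = aff_dim ?V"
      using v\<^sub>0 C(1) by (intro aff_dim_openin[of ?V])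
        (auto simp: openin_open Int_commute subspace_imp_affine intro: exI[of _ v\<^sub>0])
    moreover have "aff_dim (ball v\<^sub>0 d \<inter> ?V) \<le> aff_dim (closure C)"
      using v\<^sub>0(3) closure_subset by (intro aff_dim_subset) blast
    ultimately show "aff_dim ?V \<le> aff_dim (closure C)" by simp
  qed (use clV in \<open>rule aff_dim_subset\<close>)
  moreover have "aff_dim ?F = aff_dim (?V \<inter> ?H)"
  proof (rule antisym)
    have "q \<in> ball q e \<inter> (?V \<inter> ?H)" using q by (simp add: lform_eq_inner)
    then have ne: "ball q e \<inter> (?V \<inter> ?H) \<noteq> {}" by blast
    show "aff_dim ?F \<le> aff_dim (?V \<inter> ?H)"
      using clV F_eq by (intro aff_dim_subset) blast
    have "aff_dim (ball q e \<inter> (?V \<inter> ?H)) = aff_dim (?V \<inter> ?H)"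
      using ne by (intro aff_dim_openin[of "?V \<inter> ?H"])
        (auto simp: openin_open Int_commute subspace_imp_affine affine_Int affine_hyperplane)
    moreover have "aff_dim (ball q e \<inter> (?V \<inter> ?H)) \<le> aff_dim ?F"
      using q(4) by (intro aff_dim_subset) (auto simp: lform_eq_inner)
    ultimately show "aff_dim (?V \<inter> ?H) \<le> aff_dim ?F" by simp
  qed
  moreover have "aff_dim (?V \<inter> ?H) = aff_dim ?V - 1"
  proof -
    have "\<not> ?V \<subseteq> ?H"
      using neg[OF v\<^sub>0(1)] C(1) v\<^sub>0(1) by (auto simp: lform_eq_inner)
    moreover have "?V \<inter> ?H \<noteq> {}" using q by (auto simp: lform_eq_inner)
    ultimately show ?thesis
      by (simp add: aff_dim_affine_Int_hyperplane subspace_imp_affine)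
  qed
  moreover have "q \<in> ?F" using q by auto
  ultimately have "?F facet_of closure C"
    using face unfolding facet_of_def by auto
  with r neg show ?thesis
    unfolding simple_roots_def by (auto intro: less_imp_le)
qed

lemma closure_if_segment:
  fixes w c :: "'a::real_normed_vector"
  assumes "\<And>t. 0 < t \<Longrightarrow> t \<le> 1 \<Longrightarrow> w + t *\<^sub>R (c - w) \<in> C"
  shows "w \<in> closure C"
proof -
  have "(\<lambda>n. w + (1 / real (Suc n)) *\<^sub>R (c - w)) \<longlonglongrightarrow> w + 0 *\<^sub>R (c - w)"
    by (intro tendsto_intros LIMSEQ_Suc lim_1_over_n)
  then show ?thesis
    using assms by (intro closure_sequential[THEN iffD2] exI[of _ "\<lambda>n. w + (1 / real (Suc n)) *\<^sub>R (c - w)"]) auto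
qed

lemma minimal_subset:
  assumes "finite T" "P T"
  obtains F where "F \<subseteq> T" "P F" "\<And>G. G \<subset> F \<Longrightarrow> \<not> P G"
proof -
  have "\<exists>F. (F \<subseteq> T \<and> P F) \<and> (\<forall>G. G \<subseteq> T \<and> P G \<longrightarrow> card F \<le> card G)"
    using assms(2) by (intro ex_has_least_nat[where k = T]) simp
  then obtain F where F: "F \<subseteq> T" "P F" "\<forall>G. G \<subseteq> T \<and> P G \<longrightarrow> card F \<le> card G"
    by (elim exE conjE) (rule that)
  have "\<not> P G" if "G \<subset> F" for G
  proof
    assume "P G"
    have "finite F" using F(1) assms(1) by (rule finite_subset)
    then have "card G < card F" using that by (rule psubset_card_mono)
    moreover have "G \<subseteq> T" using that F(1) by auto
    ultimately show False using F(3) \<open>P G\<close> by (simp add: leD)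
  qed
  with F(1,2) show thesis by (rule that)
qed

section \<open>Roots of an even lattice of prime level\<close>

text \<open>The properties of the fixed sublattice from which its roots and chambers are determined.
  The axiom \<open>level\<close> leaves \<open>1\<close> and \<open>N\<close> as the only half norms of roots; a nonzero vector is
  what makes nontrivial Eichler transvections available.\<close>
locale even_prime_level =
  fixes S :: "(real^24) set" and N :: nat
  assumes prime_N: "prime N"
    and zero_mem: "0 \<in> S"
    and diff_mem: "x \<in> S \<Longrightarrow> y \<in> S \<Longrightarrow> x - y \<in> S"
    and even_norm: "x \<in> S \<Longrightarrow> \<exists>k::int. x \<bullet> x = 2 * of_int k"
    and level: "w \<in> lattice_dual S \<Longrightarrow> real N *\<^sub>R w \<in> S"
    and nontrivial: "\<exists>e\<in>S. e \<noteq> 0"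
begin

abbreviation L :: "lvec set" where "L \<equiv> lorentz_lattice S"
abbreviation V :: "lvec set" where "V \<equiv> span L"

lemma minus_mem: "x \<in> S \<Longrightarrow> - x \<in> S"
  using diff_mem[OF zero_mem] by simp

lemma add_mem: "x \<in> S \<Longrightarrow> y \<in> S \<Longrightarrow> x + y \<in> S"
  using diff_mem[of x "- y"] minus_mem by simp

lemma inner_Ints:
  assumes "x \<in> S" "y \<in> S" shows "x \<bullet> y \<in> \<int>"
proof -
  obtain a b c :: int where "x \<bullet> x = 2 * of_int a" "y \<bullet> y = 2 * of_int b"
      "(x + y) \<bullet> (x + y) = 2 * of_int c"
    using even_norm assms add_mem by meson
  then have "x \<bullet> y = of_int (c - a - b)"
    by (simp add: inner_add_left inner_add_right inner_commute)
  then show ?thesis by (metis Ints_of_int)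
qed

lemma L_iff: "(x, m, n) \<in> L \<longleftrightarrow> x \<in> S \<and> m \<in> \<int> \<and> n \<in> \<int>"
  by (simp add: lorentz_lattice_def)

lemma L_diff: "u \<in> L \<Longrightarrow> v \<in> L \<Longrightarrow> u - v \<in> L"
  by (cases u; cases v) (simp add: L_iff diff_mem)

lemma L_zero: "0 \<in> L"
  by (simp add: zero_prod_def L_iff zero_mem)

lemma L_minus: "u \<in> L \<Longrightarrow> - u \<in> L"
  using L_diff[OF L_zero] by simp

lemma L_add: "u \<in> L \<Longrightarrow> v \<in> L \<Longrightarrow> u + v \<in> L"
  using L_diff[of u "- v"] L_minus by simp

lemma L_of_int: "u \<in> L \<Longrightarrow> of_int k *\<^sub>R u \<in> L"
proof (induction k rule: int_induct[where k = 0])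
  case base then show ?case by (simp add: L_zero)
next
  case (step1 i) then show ?case by (simp add: scaleR_add_left L_add)
next
  case (step2 i) then show ?case by (simp add: scaleR_diff_left L_diff)
qed

lemma L_Ints: "u \<in> L \<Longrightarrow> t \<in> \<int> \<Longrightarrow> t *\<^sub>R u \<in> L"
  by (metis Ints_cases L_of_int)

lemma L_sum: "(\<And>i. i \<in> I \<Longrightarrow> f i \<in> L) \<Longrightarrow> sum f I \<in> L"
  by (induction I rule: infinite_finite_induct) (auto simp: L_zero L_add)

lemma rho_mem: "weyl_rho \<in> L"
  by (simp add: weyl_rho_def L_iff zero_mem)

lemma lform_Ints: "u \<in> L \<Longrightarrow> v \<in> L \<Longrightarrow> lform u v \<in> \<int>"
  by (cases u; cases v) (auto simp: L_iff lform_Pair inner_Ints)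

lemma lform_even:
  assumes "u \<in> L" shows "\<exists>k::int. lform u u = 2 * of_int k"
proof -
  obtain x m n where u: "u = (x, m, n)" by (cases u)
  then obtain i j :: int where "m = of_int i" "n = of_int j"
    using assms by (auto simp: L_iff elim!: Ints_cases)
  moreover obtain k :: int where "x \<bullet> x = 2 * of_int k"
    using even_norm assms u by (auto simp: L_iff)
  ultimately have "lform u u = 2 * of_int (k - i * j)"
    by (simp add: u lform_Pair)
  then show ?thesis ..
qed

text \<open>If a rational multiple \<open>a / k\<close> of a primitive vector is in the lattice, Bezout produces the
  multiple by the reciprocal of the reduced denominator, which must therefore be \<open>1\<close>.\<close>
lemma primitive_multiple:
  assumes r: "r \<in> L" and prim: "\<forall>n::int. \<bar>n\<bar> > 1 \<longrightarrow> (1 / of_int n) *\<^sub>R r \<notin> L"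
    and k: "k > 0" and mult: "(of_int a / of_int k) *\<^sub>R r \<in> L"
  shows "k dvd a"
proof -
  define a' k' where "a' = a div gcd a k" and "k' = k div gcd a k"
  have g: "gcd a k > 0" using k by (simp add: gcd_pos_int)
  have a: "a = a' * gcd a k" and k_eq: "k = k' * gcd a k" by (simp_all add: a'_def k'_def)
  have k': "k' > 0" using k k_eq g by (metis zero_less_mult_pos2)
  have "coprime a' k'"
    unfolding a'_def k'_def using k by (intro div_gcd_coprime) auto
  then obtain u w where "u * a' + w * k' = 1"
    using bezout_int[of a' k'] by (auto simp: coprime_iff_gcd_eq_1)
  then have "of_int u * (of_int a' / of_int k') + of_int w = (1 / of_int k' :: real)"
    using k' by (simp add: field_simps flip: of_int_mult of_int_add)
  moreover have "of_int a' / of_int k' = (of_int a / of_int k :: real)"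
    using g by (subst a, subst k_eq) simp
  ultimately have "(1 / of_int k') *\<^sub>R r =
      of_int u *\<^sub>R ((of_int a / of_int k) *\<^sub>R r) + of_int w *\<^sub>R r"
    by (simp flip: scaleR_add_left)
  also have "\<dots> \<in> L" using r mult by (intro L_add L_of_int)
  finally have "\<not> \<bar>k'\<bar> > 1" using prim by blast
  then have "k' = 1" using k' by linarith
  then show ?thesis using k_eq by (metis gcd_dvd1 mult_1)
qed

lemma root_coroot_integral:
  assumes "is_root L r"
  obtains k :: int where "k > 0" "lform r r = 2 * of_int k" "\<And>v. v \<in> L \<Longrightarrow> lform r v / of_int k \<in> \<int>"
proof -
  have r: "r \<in> L" "lform r r > 0" "\<forall>n::int. \<bar>n\<bar> > 1 \<longrightarrow> (1 / of_int n) *\<^sub>R r \<notin> L"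
    and refl: "reflection r ` L = L"
    using assms by (auto simp: is_root_def)
  obtain k :: int where k: "lform r r = 2 * of_int k" using lform_even r by blast
  have "k > 0" using r(2) k by simp
  moreover have "lform r v / of_int k \<in> \<int>" if v: "v \<in> L" for v
  proof -
    obtain a :: int where a: "lform r v = of_int a"
      using lform_Ints[OF r(1) v] by (auto elim: Ints_cases)
    have "reflection r v \<in> L" using refl v by blast
    then have "v - reflection r v \<in> L" using v L_diff by blast
    then have "(of_int a / of_int k) *\<^sub>R r \<in> L" by (simp add: reflection_def a k)
    then have "k dvd a" using primitive_multiple[OF r(1) r(3) \<open>k > 0\<close>] by blast
    then show ?thesis using \<open>k > 0\<close> by (auto simp: a)
  qed
  ultimately show thesis using that k by blast
qed

lemma dual_mem:
  assumes "x \<in> S" "t \<noteq> 0" "\<And>y. y \<in> S \<Longrightarrow> x \<bullet> y / t \<in> \<int>"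
  shows "(1 / t) *\<^sub>R x \<in> lattice_dual S"
  using assms by (auto simp: lattice_dual_def span_base span_mul)

text \<open>A root of norm \<open>2 k\<close> is \<open>k\<close> times a dual vector, so by the level condition \<open>N / k\<close> times the
  root is a lattice vector and \<open>k\<close> divides the prime \<open>N\<close>. Conversely a vector \<open>r\<close> of norm \<open>2 j\<close> in
  \<open>j L\<^sup>*\<close> is automatically primitive: a divisor \<open>n\<close> of \<open>r\<close> divides \<open>2\<close>, and \<open>r / 2\<close> would have
  norm \<open>j / 2\<close>, which is an even integer neither for \<open>j = 1\<close> nor for a prime \<open>j\<close>.\<close>
lemma is_root_iff:
  "is_root L r \<longleftrightarrow> r \<in> L \<and> (\<exists>j\<in>{1, real N}. lform r r = 2 * j \<and> (\<forall>v\<in>L. lform r v / j \<in> \<int>))"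
proof
  assume root: "is_root L r"
  then have r: "r \<in> L" "\<forall>n::int. \<bar>n\<bar> > 1 \<longrightarrow> (1 / of_int n) *\<^sub>R r \<notin> L"
    by (auto simp: is_root_def)
  obtain k :: int where k: "k > 0" "lform r r = 2 * of_int k"
    and int: "\<And>v. v \<in> L \<Longrightarrow> lform r v / of_int k \<in> \<int>"
    using root_coroot_integral[OF root] by blast
  obtain x m n where r_eq: "r = (x, m, n)" by (cases r)
  have "x \<in> S" using r r_eq by (simp add: L_iff)
  have "(1 / of_int k) *\<^sub>R x \<in> lattice_dual S"
  proof (rule dual_mem)
    fix y assume "y \<in> S"
    then show "x \<bullet> y / of_int k \<in> \<int>"
      using int[of "(y, 0, 0)"] by (simp add: L_iff r_eq lform_Pair)
  qed (use \<open>x \<in> S\<close> k in auto)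
  then have "(of_int (int N) / of_int k) *\<^sub>R x \<in> S" using level by fastforce
  moreover have "m / of_int k \<in> \<int>" "n / of_int k \<in> \<int>"
    using int[of "(0, 0, 1)"] int[of "(0, 1, 0)"]
    by (simp_all add: L_iff r_eq lform_Pair zero_mem)
  then have "real N * (m / of_int k) \<in> \<int>" "real N * (n / of_int k) \<in> \<int>"
    by (auto intro!: Ints_mult simp del: times_divide_eq_right)
  ultimately have "(of_int (int N) / of_int k) *\<^sub>R r \<in> L"
    by (simp add: r_eq L_iff)
  then have "k dvd int N" using primitive_multiple[OF r k(1)] by blast
  then have "nat k dvd N" using k(1) by (simp add: nat_dvd_iff)
  then have "nat k = 1 \<or> nat k = N" using prime_N by (auto simp: prime_nat_iff)
  then have "of_int k \<in> {1, real N}" using k(1) by auto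
  with r k int show "r \<in> L \<and> (\<exists>j\<in>{1, real N}. lform r r = 2 * j \<and> (\<forall>v\<in>L. lform r v / j \<in> \<int>))"
    by blast
next
  assume "r \<in> L \<and> (\<exists>j\<in>{1, real N}. lform r r = 2 * j \<and> (\<forall>v\<in>L. lform r v / j \<in> \<int>))"
  then obtain j where r: "r \<in> L" and j: "j \<in> {1, real N}" "lform r r = 2 * j"
    and int: "\<And>v. v \<in> L \<Longrightarrow> lform r v / j \<in> \<int>" by blast
  have "j > 0" using j(1) prime_gt_0_nat[OF prime_N] by auto
  have refl: "reflection r v = v - (lform r v / j) *\<^sub>R r" for v
    by (simp add: reflection_def j(2))
  have mem: "reflection r v \<in> L" if "v \<in> L" for v
    unfolding refl using that r int by (intro L_diff L_Ints)
  have inv: "reflection r (reflection r v) = v" for v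
    unfolding refl using \<open>j > 0\<close> by (simp add: lform_simps j(2) algebra_simps)
  have "reflection r ` L = L"
    using mem inv by (metis image_eqI subsetI subset_antisym image_subsetI)
  moreover have "(1 / of_int n) *\<^sub>R r \<notin> L" if n: "\<bar>n\<bar> > 1" for n :: int
  proof
    assume mem: "(1 / of_int n) *\<^sub>R r \<in> L"
    have "2 / of_int n \<in> (\<int> :: real set)"
      using int[OF mem] \<open>j > 0\<close> by (simp add: lform_simps j(2))
    then obtain i where i: "2 / of_int n = (of_int i :: real)" by (auto elim: Ints_cases)
    then have "of_int (i * n) = (2 :: real)" using n by (simp add: field_simps)
    then have "i * n = 2" by linarith
    then have "n dvd 2" by (metis dvd_triv_right)
    then have "n = 2 \<or> n = -2" using n dvd_imp_le_int[of 2 n] by auto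
    obtain k :: int where "lform ((1 / of_int n) *\<^sub>R r) ((1 / of_int n) *\<^sub>R r) = 2 * of_int k"
      using lform_even[OF mem] by blast
    then have "j = 4 * of_int k"
      using \<open>n = 2 \<or> n = -2\<close> by (auto simp: lform_simps j(2))
    then have "(of_int 1 :: real) = of_int (4 * k) \<or> (of_int (int N) :: real) = of_int (4 * k)"
      using j(1) by auto
    then have "1 = 4 * k \<or> int N = 4 * k" by (simp only: of_int_eq_iff)
    then have "4 dvd int N" by presburger
    then have "4 dvd N" by presburger
    then have "2 dvd N" "N \<noteq> 2" by auto
    then show False using prime_N by (metis prime_nat_iff numeral_eq_one_iff semiring_norm(85))
  qed
  ultimately show "is_root L r" using r \<open>j > 0\<close> j(2) by (simp add: is_root_def)
qed

lemma root_mem: "is_root L r \<Longrightarrow> r \<in> L" and root_pos: "is_root L r \<Longrightarrow> lform r r > 0"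
  by (auto simp: is_root_def)

lemma root_mem_V: "is_root L r \<Longrightarrow> r \<in> V"
  by (simp add: root_mem span_base)

lemma root_minus: "is_root L r \<Longrightarrow> is_root L (- r)"
  unfolding is_root_iff by (auto simp: lform_simps L_minus)

lemma norm_two_root: "r \<in> L \<Longrightarrow> lform r r = 2 \<Longrightarrow> is_root L r"
  unfolding is_root_iff by (auto simp: lform_Ints)

lemma root_norm_le: "is_root L r \<Longrightarrow> lform r r \<le> 2 * real N"
  using prime_ge_1_nat[OF prime_N] by (auto simp: is_root_iff)

section \<open>Local finiteness of the mirrors\<close>

text \<open>Distinct lattice points have Euclidean distance at least \<open>1\<close>.\<close>
lemma finite_L_bounded:
  assumes "bounded X" shows "finite (L \<inter> X)"
proof -
  have sep: "1 \<le> dist u v" if "u \<in> L" "v \<in> L" "u \<noteq> v" for u v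
  proof -
    obtain x m n where uv: "u - v = (x, m, n)" by (cases "u - v")
    have mem: "x \<in> S" "m \<in> \<int>" "n \<in> \<int>" using L_diff[OF that(1,2)] by (auto simp: uv L_iff)
    have "x \<noteq> 0 \<or> m \<noteq> 0 \<or> n \<noteq> 0" using that(3) uv
      by (metis right_minus_eq zero_prod_def)
    moreover have "1 \<le> x \<bullet> x" if "x \<noteq> 0"
    proof -
      obtain k :: int where "x \<bullet> x = 2 * of_int k" using even_norm mem by blast
      moreover have "x \<bullet> x > 0" using that by simp
      ultimately have "k \<ge> 1" and "x \<bullet> x = 2 * of_int k" by simp_all
      then show ?thesis by linarith
    qed
    moreover have "1 \<le> t\<^sup>2" if "t \<in> \<int>" "t \<noteq> 0" for t :: real
      using that Ints_nonzero_abs_ge1[of t] abs_le_square_iff[of 1 t] by simp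
    moreover have "0 \<le> x \<bullet> x" "0 \<le> m\<^sup>2" "0 \<le> n\<^sup>2" by simp_all
    ultimately have "1 \<le> x \<bullet> x + (m\<^sup>2 + n\<^sup>2)" using mem by (smt (verit))
    then show ?thesis by (simp add: dist_norm uv norm_eq_sqrt_inner power2_eq_square)
  qed
  then have "uniform_discrete (L \<inter> X)"
    unfolding uniform_discrete_def by (intro exI[of _ 1] conjI ballI impI) (simp, meson IntD1 sep not_less)
  moreover have "bounded (L \<inter> X)" using assms by (meson bounded_subset inf_le2)
  ultimately show ?thesis using uniform_discrete_finite_iff by blast
qed

text \<open>On the orthogonal complement of a vector of negative norm the form is positive definite, and
  by compactness uniformly so for all vectors near \<open>p\<close>. As the norms of roots are bounded, the
  roots whose mirrors come near \<open>p\<close> are bounded in the Euclidean norm, hence finite in number.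
  Shrinking the ball leaves only the mirrors through \<open>p\<close>.\<close>
lemma locally_finite_mirrors:
  assumes p: "lform p p < 0" and W: "open W" "p \<in> W"
  obtains e where "e > 0" "ball p e \<subseteq> W" "\<And>v. v \<in> ball p e \<Longrightarrow> lform v v < 0"
    "\<And>r q. is_root L r \<Longrightarrow> q \<in> ball p e \<Longrightarrow> lform r q = 0 \<Longrightarrow> lform r p = 0"
    "finite {r. is_root L r \<and> lform r p = 0}"
proof -
  have op: "open {v. lform v v < 0}"
    by (intro open_Collect_less continuous_intros lform.continuous_on)
  have "p \<in> {v. lform v v < 0}" using p by simp
  from bspec[OF iffD1[OF open_contains_cball op] this]
  obtain e\<^sub>0 where "e\<^sub>0 > 0 \<and> cball p e\<^sub>0 \<subseteq> {v. lform v v < 0}"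
    by (rule exE)
  then have e\<^sub>0: "e\<^sub>0 > 0" "cball p e\<^sub>0 \<subseteq> {v. lform v v < 0}" by simp_all
  define T where "T = {r. is_root L r \<and> (\<exists>q\<in>cball p e\<^sub>0. lform r q = 0)}"
  have "finite T"
  proof -
    \<comment> \<open>The pairs of a unit vector and a point near \<open>p\<close> orthogonal to it; the
      norm is positive on this compact set.\<close>
    define K where "K = (sphere 0 1 \<times> cball p e\<^sub>0) \<inter> {uq. lform (fst uq) (snd uq) = 0}"
    have "compact K" unfolding K_def
      by (intro compact_Int_closed compact_Times compact_sphere compact_cball
          closed_Collect_eq continuous_intros lform.continuous_on)
    have pos: "lform (fst uq) (fst uq) > 0" if "uq \<in> K" for uq
    proof -
      have "snd uq \<in> cball p e\<^sub>0" "lform (fst uq) (snd uq) = 0" "norm (fst uq) = 1"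
        using that by (auto simp: K_def)
      moreover from this have "fst uq \<noteq> 0" by (metis norm_zero zero_neq_one)
      moreover have "lform (snd uq) (snd uq) < 0"
        using subsetD[OF e\<^sub>0(2) \<open>snd uq \<in> cball p e\<^sub>0\<close>] by simp
      ultimately show ?thesis by (intro orthogonal_to_timelike[of "snd uq"])
    qed
    obtain c where c: "c > 0" "\<And>uq. uq \<in> K \<Longrightarrow> c \<le> lform (fst uq) (fst uq)"
    proof (cases "K = {}")
      case False
      have "continuous_on K (\<lambda>uq. lform (fst uq) (fst uq))"
        by (intro continuous_intros lform.continuous_on)
      from continuous_attains_inf[OF \<open>compact K\<close> False this]
      show thesis
        by (rule bexE) (rule that, erule pos, erule bspec, assumption)
    next
      case True
      show thesis by (rule that[of 1]) (use True in simp_all)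
    qed
    have "norm r \<le> sqrt (2 * real N / c)" if "r \<in> T" for r
    proof -
      have r: "is_root L r" and "\<exists>q\<in>cball p e\<^sub>0. lform r q = 0"
        using that by (simp_all add: T_def)
      from this(2) obtain q where q: "q \<in> cball p e\<^sub>0" "lform r q = 0" by (rule bexE)
      have "r \<noteq> 0" using root_pos[OF r] by (auto simp: lform.zero_left)
      then have "((1 / norm r) *\<^sub>R r, q) \<in> K"
        using q by (simp add: K_def lform_simps)
      from c(2)[OF this] have "c \<le> lform r r / (norm r)\<^sup>2"
        by (simp add: lform_simps power2_eq_square)
      also have "\<dots> \<le> 2 * real N / (norm r)\<^sup>2"
        using root_norm_le[OF r] by (simp add: divide_right_mono)
      finally have "(norm r)\<^sup>2 \<le> 2 * real N / c"
        using c(1) \<open>r \<noteq> 0\<close> by (simp add: field_simps)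
      then show ?thesis by (rule real_le_rsqrt)
    qed
    moreover have "r \<in> L" if "r \<in> T" for r
      using that by (simp add: T_def root_mem)
    ultimately have "T \<subseteq> L \<inter> cball 0 (sqrt (2 * real N / c))"
      by (intro subsetI) simp
    then show ?thesis by (rule finite_subset) (simp add: finite_L_bounded)
  qed
  define G where "G = W \<inter> ball p e\<^sub>0 \<inter> (\<Inter>r\<in>{r\<in>T. lform r p \<noteq> 0}. {v. lform r v \<noteq> 0})"
  have "open G" unfolding G_def using \<open>finite T\<close>
    by (intro open_Int W open_ball open_INT ballI open_Collect_neq continuous_intros
        lform.continuous_on) auto
  moreover have "p \<in> G" using W e\<^sub>0 by (simp add: G_def)
  ultimately obtain e where e: "e > 0" "ball p e \<subseteq> G" by (meson open_contains_ball)
  show thesis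
  proof (rule that[OF e(1)])
    show "ball p e \<subseteq> W" using e by (auto simp: G_def)
    show "lform v v < 0" if "v \<in> ball p e" for v
    proof -
      have "v \<in> cball p e\<^sub>0" using subsetD[OF e(2) that] by (simp add: G_def)
      then show ?thesis using subsetD[OF e\<^sub>0(2)] by blast
    qed
    show "lform r p = 0" if "is_root L r" "q \<in> ball p e" "lform r q = 0" for r q
    proof -
      have "q \<in> G" using that e by blast
      moreover from this have "q \<in> cball p e\<^sub>0" by (simp add: G_def)
      then have "r \<in> T" unfolding T_def using that by (intro CollectI conjI bexI[of _ q])
      ultimately show ?thesis using that(3) by (simp add: G_def) blast
    qed
    have "{r. is_root L r \<and> lform r p = 0} \<subseteq> T"
      unfolding T_def using e\<^sub>0(1) by (intro Collect_mono impI conjI bexI[of _ p]) simp_all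
    then show "finite {r. is_root L r \<and> lform r p = 0}" using \<open>finite T\<close> by (rule finite_subset)
  qed
qed

lemma chamber_subset:
  assumes "weyl_chamber L C"
  shows "C \<subseteq> V" "v \<in> C \<Longrightarrow> lform v v < 0" "v \<in> C \<Longrightarrow> is_root L r \<Longrightarrow> lform r v \<noteq> 0"
  using in_components_subset[OF assms[unfolded weyl_chamber_def]] by blast+

lemma chamber_open:
  assumes C: "weyl_chamber L C" and v: "v \<in> C"
  obtains d where "d > 0" "ball v d \<inter> V \<subseteq> C"
proof -
  let ?U = "{v \<in> V. lform v v < 0 \<and> (\<forall>r. is_root L r \<longrightarrow> lform r v \<noteq> 0)}"
  note sub = chamber_subset[OF C]
  obtain d where d: "d > 0" "\<And>u. u \<in> ball v d \<Longrightarrow> lform u u < 0"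
    "\<And>r q. is_root L r \<Longrightarrow> q \<in> ball v d \<Longrightarrow> lform r q = 0 \<Longrightarrow> lform r v = 0"
    by (rule locally_finite_mirrors[OF sub(2)[OF v] open_UNIV UNIV_I]) blast
  have "ball v d \<inter> V \<subseteq> C"
  proof (rule components_maximal)
    show "C \<in> components ?U" using C by (simp add: weyl_chamber_def)
    show "connected (ball v d \<inter> V)"
      by (intro convex_connected convex_Int convex_ball subspace_imp_convex) simp
    show "ball v d \<inter> V \<subseteq> ?U" using d(2,3) sub(3)[OF v] by blast
    show "C \<inter> (ball v d \<inter> V) \<noteq> {}" using v d(1) sub(1) by auto
  qed
  with d(1) show thesis using that by blast
qed

section \<open>A chamber is cut out by its simple roots\<close>

lemma chamber_convex:
  assumes "weyl_chamber L C" shows "convex C"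
proof (cases "C = {}")
  case False
  then show ?thesis using weyl_chamber_eq_cell[OF assms] convex_chamber_cell by fastforce
qed simp

lemma chamber_same_sign:
  assumes C: "weyl_chamber L C" and "v \<in> C" "w \<in> C" "is_root L r"
  shows "lform r v * lform r w > 0"
  using weyl_chamber_eq_cell[OF C \<open>v \<in> C\<close>] assms by (auto simp: chamber_cell_def)

lemma chamber_time_cone:
  assumes C: "weyl_chamber L C" and "v \<in> C" "w \<in> C"
  shows "w \<in> time_cone (lform v weyl_rho)"
  using weyl_chamber_eq_cell[OF C \<open>v \<in> C\<close>] assms by (auto simp: chamber_cell_def)

text \<open>The part of the segment inside the chamber is open in the segment and not all of it, so it is
  not closed.\<close>
lemma chamber_boundary_point:
  assumes C: "weyl_chamber L C" and v\<^sub>0: "v\<^sub>0 \<in> C" and v: "v \<in> V" "v \<notin> C"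
  obtains p where "p \<in> closed_segment v\<^sub>0 v" "p \<in> closure C" "p \<notin> C"
proof -
  let ?I = "closed_segment v\<^sub>0 v"
  have sub: "?I \<subseteq> V"
    using v\<^sub>0 v chamber_subset(1)[OF C]
    by (intro closed_segment_subset subspace_imp_convex subspace_span) auto
  have "\<not> ?I \<inter> closure C \<subseteq> C"
  proof
    assume "?I \<inter> closure C \<subseteq> C"
    then have "?I \<inter> C = ?I \<inter> closure C" using closure_subset by blast
    then have "closedin (top_of_set ?I) (?I \<inter> C)"
      by (metis closed_closure closedin_closed_Int)
    moreover have "openin (top_of_set ?I) (?I \<inter> C)"
      unfolding openin_contains_ball
    proof (intro conjI ballI)
      fix x assume "x \<in> ?I \<inter> C"
      then obtain d where "d > 0" "ball x d \<inter> V \<subseteq> C" using chamber_open[OF C] by blast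
      then show "\<exists>e>0. ball x e \<inter> ?I \<subseteq> ?I \<inter> C" using sub by blast
    qed simp
    ultimately have "?I \<inter> C = {} \<or> ?I \<inter> C = ?I"
      using connected_clopen[of ?I] by simp
    then show False using v\<^sub>0 v(2) ends_in_segment by blast
  qed
  then show thesis using that by blast
qed

text \<open>Leave the chamber along the segment from \<open>v\<^sub>0\<close> to \<open>v\<close> and let \<open>p\<close> be a boundary point on it.
  Near \<open>p\<close> only the finitely many mirrors through \<open>p\<close> matter, so the chamber looks like a
  polyhedral cone there. An element of a minimal set of roots describing that cone is a facet
  normal, hence a simple root; and any root through \<open>p\<close> that is negative at \<open>v\<^sub>0\<close> is nonnegative
  at \<open>v\<close>.\<close>
lemma chamber_separated_by_simple_root:
  assumes C: "weyl_chamber L C" and v\<^sub>0: "v\<^sub>0 \<in> C"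
    and v: "v \<in> V" "v \<in> time_cone (lform v\<^sub>0 weyl_rho)" "v \<notin> C"
  obtains r where "r \<in> simple_roots L C" "lform r v \<ge> 0"
proof -
  define P where "P = time_cone (lform v\<^sub>0 weyl_rho)"
  note sub = chamber_subset[OF C]
  obtain p where p_seg: "p \<in> closed_segment v\<^sub>0 v" and p: "p \<in> closure C" "p \<notin> C"
    using chamber_boundary_point[OF C v\<^sub>0 v(1,3)] by blast
  have v\<^sub>0P: "v\<^sub>0 \<in> P" using chamber_time_cone[OF C v\<^sub>0 v\<^sub>0] by (simp add: P_def)
  have v\<^sub>0V: "v\<^sub>0 \<in> V" using v\<^sub>0 sub(1) by blast
  have pV: "p \<in> V"
    using closed_segment_subset[OF v\<^sub>0V v(1)] p_seg by (auto simp: subspace_imp_convex)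
  have pP: "p \<in> P"
    using closed_segment_subset[OF v\<^sub>0P, of v] p_seg v(2) by (auto simp: P_def convex_time_cone)
  then have timelike: "lform p p < 0" by (simp add: P_def time_cone_def)
  have openP: "open P" by (simp add: P_def open_time_cone)
  obtain e where e: "e > 0" "ball p e \<subseteq> P"
    and mirror: "\<And>r q. is_root L r \<Longrightarrow> q \<in> ball p e \<Longrightarrow> lform r q = 0 \<Longrightarrow> lform r p = 0"
    and fin: "finite {r. is_root L r \<and> lform r p = 0}"
    by (rule locally_finite_mirrors[OF timelike openP pP]) (rule that, assumption+)
  define T where "T = {r. is_root L r \<and> lform r p = 0 \<and> lform r v\<^sub>0 < 0}"
  have "finite T" using fin by (rule rev_finite_subset) (auto simp: T_def)
  obtain c where c: "c \<in> C" "c \<in> ball p e"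
    using p(1) e(1) by (auto simp: closure_approachable dist_commute)
  have Tc: "lform r u < 0" if "r \<in> T" "u \<in> C" for r u
    using chamber_same_sign[OF C v\<^sub>0 that(2), of r] that by (auto simp: T_def zero_less_mult_iff)
  have local: "u \<in> C" if u: "u \<in> V" "u \<in> ball p e" and uT: "\<And>r. r \<in> T \<Longrightarrow> lform r u < 0" for u
  proof -
    have "lform r c * lform r u > 0" if r: "is_root L r" for r
    proof (cases "lform r p = 0")
      case False
      show ?thesis
      proof (rule connected_nonzero_same_sign[of "ball p e" "lform r", OF connected_ball _ _ c(2) u(2)])
        show "continuous_on (ball p e) (lform r)" by (intro lform.continuous_on continuous_intros)
        show "lform r w \<noteq> 0" if "w \<in> ball p e" for w using mirror[OF r that] False by blast
      qed
    next
      case True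
      have "r \<in> T \<or> - r \<in> T"
        using r root_minus[OF r] True sub(3)[OF v\<^sub>0 r] by (auto simp: T_def lform_simps)
      then show ?thesis
      proof
        assume "r \<in> T"
        with uT Tc[OF _ c(1)] show ?thesis by (intro mult_neg_neg)
      next
        assume "- r \<in> T"
        with uT[of "- r"] Tc[of "- r", OF _ c(1)] show ?thesis by (simp add: lform_simps)
      qed
    qed
    moreover have "u \<in> time_cone (lform c weyl_rho)"
    proof -
      have "u \<in> P" "c \<in> P" using e(2) u(2) c(2) by auto
      then show ?thesis by (auto simp: P_def time_cone_def zero_less_mult_iff)
    qed
    ultimately show ?thesis
      using u(1) weyl_chamber_eq_cell[OF C c(1)] by (auto simp: chamber_cell_def)
  qed
  have "T \<noteq> {}"
  proof
    assume "T = {}"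
    then have "p \<in> C" using e(1) by (intro local[OF pV]) simp_all
    with p(2) show False by contradiction
  qed
  \<comment> \<open>\<open>Q F\<close> says that the roots in \<open>F\<close> already cut out the
    polyhedral cone defined by \<open>T\<close>.\<close>
  define Q where "Q F \<longleftrightarrow> (\<forall>u\<in>V. (\<forall>r\<in>F. lform r u \<le> 0) \<longrightarrow> (\<forall>r\<in>T. lform r u \<le> 0))" for F
  have "Q T" by (simp add: Q_def)
  obtain F where F: "F \<subseteq> T" "Q F" "\<And>G. G \<subset> F \<Longrightarrow> \<not> Q G"
    by (rule minimal_subset[of T Q, OF \<open>finite T\<close> \<open>Q T\<close>]) (rule that, assumption+)
  have "F \<noteq> {}"
  proof
    assume "F = {}"
    obtain r where "r \<in> T" using \<open>T \<noteq> {}\<close> by blast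
    then have "lform r (- v\<^sub>0) \<le> 0"
      using F(2) bspec[of V _ "- v\<^sub>0"] v\<^sub>0V \<open>F = {}\<close> by (simp add: Q_def span_neg)
    then show False using \<open>r \<in> T\<close> by (simp add: T_def lform_simps)
  qed
  then obtain r where r: "r \<in> F" by blast
  then have rT: "r \<in> T" and root: "is_root L r" and rp: "lform r p = 0" and rv\<^sub>0: "lform r v\<^sub>0 < 0"
    using F(1) by (auto simp: T_def)
  have "\<not> Q (F - {r})" using F(3) r by blast
  then obtain u where u: "u \<in> V" "\<And>s. s \<in> F - {r} \<Longrightarrow> lform s u \<le> 0"
    and nT: "\<not> (\<forall>s\<in>T. lform s u \<le> 0)" unfolding Q_def by meson
  have ru: "lform r u > 0"
  proof (rule ccontr)
    assume "\<not> ?thesis"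
    then have "lform s u \<le> 0" if "s \<in> F" for s
      using u(2)[of s] that by (cases "s = r") simp_all
    then show False using F(2) u(1) nT by (simp add: Q_def)
  qed
  \<comment> \<open>The segment from \<open>v\<^sub>0\<close> to \<open>u\<close> crosses the mirror of
    \<open>r\<close> at (a multiple of) this point, where all other roots in \<open>F\<close> are still
    negative; adding a small multiple of it to \<open>p\<close> gives a point in the interior of the
    facet.\<close>
  define q\<^sub>0 where "q\<^sub>0 = lform r u *\<^sub>R v\<^sub>0 - lform r v\<^sub>0 *\<^sub>R u"
  have q\<^sub>0: "q\<^sub>0 \<in> V" "lform r q\<^sub>0 = 0" using v\<^sub>0V u(1)
    by (simp_all add: q\<^sub>0_def span_diff span_mul lform_simps)
  have q\<^sub>0_neg: "lform s q\<^sub>0 < 0" if "s \<in> F - {r}" for s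
  proof -
    have "lform s v\<^sub>0 < 0" using that F(1) by (auto simp: T_def)
    then have "lform r u * lform s v\<^sub>0 < 0" using ru by (simp add: mult_pos_neg)
    moreover have "lform r v\<^sub>0 * lform s u \<ge> 0" using rv\<^sub>0 u(2)[OF that] by (simp add: mult_nonpos_nonpos)
    ultimately show ?thesis by (simp add: q\<^sub>0_def lform_simps)
  qed
  define d where "d = e / (2 * (norm q\<^sub>0 + 1))"
  have "d > 0" using e(1) by (simp add: d_def add_nonneg_pos)
  define q where "q = p + d *\<^sub>R q\<^sub>0"
  have q_ball: "q \<in> ball p e"
  proof -
    have "norm (d *\<^sub>R q\<^sub>0) = e * (norm q\<^sub>0 / (2 * (norm q\<^sub>0 + 1)))"
      using e(1) by (simp add: d_def)
    also have "\<dots> < e * 1" using e(1)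
      by (intro mult_strict_left_mono) (auto simp: divide_less_eq add_nonneg_pos)
    finally show ?thesis by (simp add: q_def dist_norm)
  qed
  define W where "W = ball p e \<inter> (\<Inter>s\<in>F - {r}. {w. lform s w < 0})"
  have "finite F" using F(1) \<open>finite T\<close> finite_subset by blast
  then have "open W" unfolding W_def
    by (intro open_Int open_ball open_INT ballI open_Collect_less continuous_intros
        lform.continuous_on) auto
  moreover have "q \<in> W"
  proof -
    have "lform s q < 0" if "s \<in> F - {r}" for s
    proof -
      have "lform s p = 0" using that F(1) by (auto simp: T_def)
      then show ?thesis using q\<^sub>0_neg[OF that] \<open>d > 0\<close> by (simp add: q_def lform_simps mult_pos_neg)
    qed
    then show ?thesis using q_ball by (simp add: W_def)
  qed
  ultimately obtain e' where e': "e' > 0" "ball q e' \<subseteq> W" by (meson open_contains_ball)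
  have wall: "w \<in> closure C" if w: "w \<in> ball q e'" "w \<in> V" "lform r w = 0" for w
  proof (rule closure_if_segment[of w c])
    fix t :: real assume t: "0 < t" "t \<le> 1"
    have wW: "w \<in> W" using w e' by blast
    have "\<forall>s\<in>F. lform s w \<le> 0"
    proof
      fix s assume "s \<in> F"
      then show "lform s w \<le> 0"
        using wW w(3) by (cases "s = r") (simp_all add: W_def less_imp_le)
    qed
    then have wT: "\<forall>s\<in>T. lform s w \<le> 0" using F(2) w(2) by (simp add: Q_def)
    have eq: "w + t *\<^sub>R (c - w) = (1 - t) *\<^sub>R w + t *\<^sub>R c" by (simp add: algebra_simps)
    show "w + t *\<^sub>R (c - w) \<in> C"
    proof (rule local)
      show "w + t *\<^sub>R (c - w) \<in> V" using w(2) c(1) sub(1) by (auto intro!: span_add span_mul span_diff)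
      show "w + t *\<^sub>R (c - w) \<in> ball p e"
        unfolding eq using wW c(2) t by (intro convexD[OF convex_ball]) (auto simp: W_def)
      show "lform s (w + t *\<^sub>R (c - w)) < 0" if "s \<in> T" for s
      proof -
        have "(1 - t) * lform s w \<le> 0" using wT that t by (simp add: mult_nonneg_nonpos)
        moreover have "t * lform s c < 0" using Tc[OF that c(1)] t by (simp add: mult_pos_neg)
        ultimately show ?thesis by (simp add: eq lform_simps)
      qed
    qed
  qed
  obtain d\<^sub>0 where d\<^sub>0: "d\<^sub>0 > 0" "ball v\<^sub>0 d\<^sub>0 \<inter> V \<subseteq> C" using chamber_open[OF C v\<^sub>0] by blast
  have qV: "q \<in> V" using pV q\<^sub>0(1) by (simp add: q_def span_add span_mul)
  have rq: "lform r q = 0" using rp q\<^sub>0(2) by (simp add: q_def lform_simps)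
  have "r \<in> simple_roots L C"
  proof (rule simple_root_if_wall[OF root sub(1) chamber_convex[OF C] _ v\<^sub>0 d\<^sub>0 qV rq e'(1)])
    show "lform r u < 0" if "u \<in> C" for u using rT that by (rule Tc)
    show "u \<in> closure C" if "u \<in> ball q e'" "u \<in> V" "lform r u = 0" for u
      using that by (rule wall)
  qed
  moreover have "lform r v \<ge> 0"
  proof -
    obtain s where s: "0 \<le> s" "s \<le> 1" "p = (1 - s) *\<^sub>R v\<^sub>0 + s *\<^sub>R v"
      using p_seg by (auto simp: closed_segment_def)
    then have eq: "(1 - s) * lform r v\<^sub>0 + s * lform r v = 0" using rp by (simp add: lform_simps)
    have "s \<noteq> 0" using eq rv\<^sub>0 by auto
    moreover have "(1 - s) * lform r v\<^sub>0 \<le> 0" using s rv\<^sub>0 by (simp add: mult_nonneg_nonpos)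
    ultimately have "s > 0" "s * lform r v \<ge> 0" using eq s(1) by linarith+
    then show ?thesis by (simp add: zero_le_mult_iff)
  qed
  ultimately show thesis using that by blast
qed

lemma simple_root_neg:
  assumes C: "weyl_chamber L C" and "r \<in> simple_roots L C" "v \<in> C"
  shows "is_root L r" "lform r v < 0"
proof -
  show "is_root L r" using assms(2) by (simp add: simple_roots_def)
  then have "lform r v \<noteq> 0" by (rule chamber_subset(3)[OF C assms(3)])
  moreover have "\<forall>v\<in>C. lform r v \<le> 0" using assms(2) unfolding simple_roots_def by blast
  then have "lform r v \<le> 0" using assms(3) by (rule bspec)
  ultimately show "lform r v < 0" by simp
qed

section \<open>The roots compatible with the Weyl vector\<close>

definition norm_2_family :: "lvec set" where
  "norm_2_family = {(l, 1, (l \<bullet> l) / 2 - 1) | l. l \<in> S}"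

definition norm_2N_family :: "lvec set" where
  "norm_2N_family = {(l, real N, (l \<bullet> l) / (2 * real N) - 1) | l.
     l \<in> (\<lambda>v. real N *\<^sub>R v) ` lattice_dual S \<and>
     (\<exists>k::int. (l \<bullet> l) / (2 * real N) - 1 = real N * of_int k)}"

definition weyl_roots :: "lvec set" where
  "weyl_roots = {r. is_root L r \<and> lform r weyl_rho = - lform r r / 2}"

lemma N_pos: "real N > 0"
  using prime_gt_0_nat[OF prime_N] by simp

lemma norm_2_family_root:
  assumes "l \<in> S"
  shows "(l, 1, (l \<bullet> l) / 2 - 1) \<in> L" "lform (l, 1, (l \<bullet> l) / 2 - 1) (l, 1, (l \<bullet> l) / 2 - 1) = 2"
proof -
  obtain k :: int where "l \<bullet> l = 2 * of_int k" using even_norm assms by blast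
  then show "(l, 1, (l \<bullet> l) / 2 - 1) \<in> L" using assms by (simp add: L_iff)
qed (simp add: lform_Pair)

lemma norm_2_family_subset: "norm_2_family \<subseteq> weyl_roots"
proof
  fix r assume "r \<in> norm_2_family"
  then obtain l where l: "l \<in> S" "r = (l, 1, (l \<bullet> l) / 2 - 1)"
    by (auto simp: norm_2_family_def)
  with norm_2_family_root[OF l(1)] show "r \<in> weyl_roots"
    by (simp add: weyl_roots_def norm_two_root lform_rho_Pair)
qed

lemma norm_2N_family_subset: "norm_2N_family \<subseteq> weyl_roots"
proof
  fix r assume "r \<in> norm_2N_family"
  then obtain w k where w: "w \<in> lattice_dual S"
    and k: "(real N *\<^sub>R w) \<bullet> (real N *\<^sub>R w) / (2 * real N) - 1 = real N * of_int k"
    and r: "r = (real N *\<^sub>R w, real N, real N * of_int k)"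
    unfolding norm_2N_family_def by fastforce
  have "r \<in> L" using level[OF w] by (simp add: r L_iff)
  have norm: "lform r r = 2 * real N"
    using k N_pos by (simp add: r lform_Pair field_simps)
  have "lform r v / real N \<in> \<int>" if "v \<in> L" for v
  proof -
    obtain y a b where v: "v = (y, a, b)" by (cases v)
    then have "w \<bullet> y \<in> \<int>" "a \<in> \<int>" "b \<in> \<int>"
      using that w by (simp_all add: L_iff lattice_dual_def)
    moreover have "lform r v / real N = w \<bullet> y - b - of_int k * a"
      using N_pos by (simp add: r v lform_Pair field_simps)
    ultimately show ?thesis by simp
  qed
  then have "is_root L r" using \<open>r \<in> L\<close> norm unfolding is_root_iff by blast
  then show "r \<in> weyl_roots" using norm by (simp add: weyl_roots_def r lform_rho_Pair)
qed

text \<open>The form in which membership is used: such a root has norm \<open>2 j\<close> and height \<open>j\<close>, and is \<open>j\<close>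
  times a dual vector.\<close>
lemma weyl_roots_obtain:
  assumes "r \<in> weyl_roots"
  obtains j where "j = 1 \<or> j = real N" "lform r r = 2 * j" "lform r weyl_rho = - j"
    "r \<in> L" "\<And>v. v \<in> L \<Longrightarrow> lform r v / j \<in> \<int>"
proof -
  have root: "is_root L r" and rho: "lform r weyl_rho = - lform r r / 2"
    using assms by (simp_all add: weyl_roots_def)
  then obtain j where j: "j \<in> {1, real N}" "lform r r = 2 * j" "\<forall>v\<in>L. lform r v / j \<in> \<int>"
    and "r \<in> L" unfolding is_root_iff by blast
  show thesis using j rho \<open>r \<in> L\<close> by (intro that[of j]) simp_all
qed

lemma weyl_roots_eq: "weyl_roots = norm_2_family \<union> norm_2N_family"
proof
  show "norm_2_family \<union> norm_2N_family \<subseteq> weyl_roots"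
    using norm_2_family_subset norm_2N_family_subset by simp
  show "weyl_roots \<subseteq> norm_2_family \<union> norm_2N_family"
  proof
    fix r assume "r \<in> weyl_roots"
    then obtain j where j: "j = 1 \<or> j = real N" "lform r r = 2 * j" "lform r weyl_rho = - j"
      and "r \<in> L" and int: "\<And>v. v \<in> L \<Longrightarrow> lform r v / j \<in> \<int>"
      by (rule weyl_roots_obtain) (rule that, assumption+)
    obtain x n where r: "r = (x, j, n)"
      using j(3) by (cases r) (simp add: lform_rho_Pair)
    have "j > 0" using j(1) N_pos by auto
    have "x \<in> S" using \<open>r \<in> L\<close> by (simp add: r L_iff)
    have n: "n = (x \<bullet> x) / (2 * j) - 1"
      using j(2) \<open>j > 0\<close> by (simp add: r lform_Pair field_simps)
    from j(1) show "r \<in> norm_2_family \<union> norm_2N_family"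
    proof
      assume "j = 1"
      then have "r = (x, 1, (x \<bullet> x) / 2 - 1)" using r n by simp
      with \<open>x \<in> S\<close> have "r \<in> norm_2_family" unfolding norm_2_family_def by blast
      then show ?thesis ..
    next
      assume jN: "j = real N"
      have "(1 / real N) *\<^sub>R x \<in> lattice_dual S"
      proof (rule dual_mem[OF \<open>x \<in> S\<close>])
        fix y assume "y \<in> S"
        then show "x \<bullet> y / real N \<in> \<int>"
          using int[of "(y, 0, 0)"] by (simp add: L_iff r lform_Pair jN)
      qed (use N_pos in simp)
      moreover have "x = real N *\<^sub>R ((1 / real N) *\<^sub>R x)" using N_pos by simp
      ultimately have x: "x \<in> (\<lambda>v. real N *\<^sub>R v) ` lattice_dual S" by (rule rev_image_eqI)
      have "- (n / real N) \<in> \<int>"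
        using int[of "(0, 1, 0)"] by (simp add: L_iff zero_mem r lform_Pair jN)
      then have "n / real N \<in> \<int>" using minus_in_Ints_iff by blast
      then obtain k :: int where "n / real N = of_int k" by (rule Ints_cases)
      then have k: "n = real N * of_int k" using N_pos by (simp add: field_simps)
      have "r = (x, real N, (x \<bullet> x) / (2 * real N) - 1)" using r n jN by simp
      moreover have "(x \<bullet> x) / (2 * real N) - 1 = real N * of_int k" using k n jN by simp
      ultimately have "r \<in> norm_2N_family" unfolding norm_2N_family_def using x by blast
      then show ?thesis ..
    qed
  qed
qed

lemma rho_orthogonal_norm:
  assumes "lform s weyl_rho = 0"
  shows "lform s s \<ge> 0" and "lform s s = 0 \<Longrightarrow> \<exists>c. s = c *\<^sub>R weyl_rho"
proof -
  obtain d c where s: "s = (d, 0, c)"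
    using assms by (cases s) (simp add: lform_rho_Pair)
  show "lform s s \<ge> 0" by (simp add: s lform_Pair)
  assume "lform s s = 0"
  then have "d = 0" by (simp add: s lform_Pair)
  then show "\<exists>c. s = c *\<^sub>R weyl_rho" by (intro exI[of _ c]) (simp add: s weyl_rho_def)
qed

text \<open>Subtracting the root of larger height from a multiple of the other one, so that the heights
  cancel, gives a vector \<open>s\<close> orthogonal to \<open>\<rho>\<close>, which has nonnegative norm. If \<open>(r, r')\<close> were
  positive, this would leave two possibilities: \<open>s\<close> has norm \<open>2 j'\<close> and is a root orthogonal to
  \<open>\<rho>\<close>, or \<open>s\<close> has norm \<open>0\<close> and \<open>r = r'\<close>.\<close>
lemma weyl_roots_obtuse_aux:
  assumes no_orth: "\<And>s. is_root L s \<Longrightarrow> lform s weyl_rho \<noteq> 0"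
    and neq: "r \<noteq> r'" and j: "j = j' \<or> j = 1" and j': "j' = 1 \<or> j' = real N"
    and r: "lform r r = 2 * j" "lform r weyl_rho = - j" "r \<in> L"
      "\<And>v. v \<in> L \<Longrightarrow> lform r v / j \<in> \<int>"
    and r': "lform r' r' = 2 * j'" "lform r' weyl_rho = - j'" "r' \<in> L"
      "\<And>v. v \<in> L \<Longrightarrow> lform r' v / j' \<in> \<int>"
  shows "lform r r' \<le> 0"
proof (rule ccontr)
  assume "\<not> ?thesis"
  then have pos: "lform r r' > 0" by simp
  have "j' > 0" "j > 0" using j j' N_pos by auto
  obtain i :: int where "lform r' r / j' = of_int i" using r'(4)[OF r(3)] by (rule Ints_cases)
  then have i: "lform r r' = of_int i * j'"
    using \<open>j' > 0\<close> by (simp add: field_simps lform_commute[of r r'])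
  then have "i \<ge> 1" using pos \<open>j' > 0\<close> by (simp add: zero_less_mult_iff)
  define q where "q = j' / j"
  have q_int: "q \<in> \<int>" using j j' \<open>j' > 0\<close> by (auto simp: q_def)
  have qj: "q * j = j'" using \<open>j > 0\<close> by (simp add: q_def)
  have "1 \<le> j'" using j' prime_ge_1_nat[OF prime_N] by auto
  then have q1: "q \<ge> 1" using j \<open>j' > 0\<close> by (auto simp: q_def)
  define s where "s = q *\<^sub>R r - r'"
  have sL: "s \<in> L" unfolding s_def using r(3) r'(3) q_int by (intro L_diff L_Ints)
  have s_rho: "lform s weyl_rho = 0"
    by (simp add: s_def lform_simps r(2) r'(2) qj)
  have "lform s s = q * (q * j) * 2 - 2 * q * lform r r' + 2 * j'"
    by (simp add: s_def lform_simps r(1) r'(1) lform_commute[of r' r] algebra_simps)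
  then have s_norm: "lform s s = 2 * j' * (q * (1 - of_int i) + 1)"
    unfolding qj i by (simp add: algebra_simps)
  show False
  proof (cases "i = 1")
    case True
    have "lform s v / j' \<in> \<int>" if "v \<in> L" for v
    proof -
      have "lform s v / j' = lform r v / j - lform r' v / j'"
        using \<open>j > 0\<close> \<open>j' > 0\<close> by (simp add: s_def lform_simps q_def field_simps)
      then show ?thesis using r(4)[OF that] r'(4)[OF that] by simp
    qed
    then have "is_root L s"
      unfolding is_root_iff using sL j' s_norm True by auto
    with no_orth s_rho show False by blast
  next
    case False
    then have "i \<ge> 2" using \<open>i \<ge> 1\<close> by simp
    then have "(1::real) - of_int i \<le> - 1" by simp
    then have le: "q * (1 - of_int i) \<le> q * (- 1)" using q1 by (intro mult_left_mono) auto
    have "0 \<le> q * (1 - of_int i) + 1"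
      using rho_orthogonal_norm(1)[OF s_rho] \<open>j' > 0\<close> by (simp add: s_norm zero_le_mult_iff)
    then have "q = 1" and "q * (1 - of_int i) + 1 = 0" using le q1 by linarith+
    then have "lform s s = 0" by (simp add: s_norm)
    from rho_orthogonal_norm(2)[OF s_rho this] obtain c where "s = c *\<^sub>R weyl_rho" by (rule exE)
    then have "r - r' = c *\<^sub>R weyl_rho" using \<open>q = 1\<close> by (simp add: s_def)
    then have r_eq: "r = r' + c *\<^sub>R weyl_rho" by (metis add.commute diff_add_cancel)
    have "lform r r = lform r' r' + 2 * c * lform r' weyl_rho"
      by (simp add: r_eq lform_simps lform_rho_rho lform_commute[of weyl_rho r'])
    moreover have "j = j'" using \<open>q = 1\<close> qj by simp
    ultimately have "c = 0" using r(1) r'(1,2) \<open>j' > 0\<close> by simp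
    then show False using neq r_eq by simp
  qed
qed

lemma weyl_roots_obtuse:
  assumes no_orth: "\<And>s. is_root L s \<Longrightarrow> lform s weyl_rho \<noteq> 0"
    and "r \<in> weyl_roots" "r' \<in> weyl_roots" "r \<noteq> r'"
  shows "lform r r' \<le> 0"
proof -
  obtain j where j: "j = 1 \<or> j = real N" and r: "lform r r = 2 * j" "lform r weyl_rho = - j"
    "r \<in> L" "\<And>v. v \<in> L \<Longrightarrow> lform r v / j \<in> \<int>"
    using assms(2) by (rule weyl_roots_obtain) (rule that, assumption+)
  obtain j' where j': "j' = 1 \<or> j' = real N" and r': "lform r' r' = 2 * j'"
    "lform r' weyl_rho = - j'" "r' \<in> L" "\<And>v. v \<in> L \<Longrightarrow> lform r' v / j' \<in> \<int>"
    using assms(3) by (rule weyl_roots_obtain) (rule that, assumption+)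
  show ?thesis
  proof (cases "j = j' \<or> j = 1")
    case True
    show ?thesis by (rule weyl_roots_obtuse_aux[OF no_orth assms(4) True j' r r'])
  next
    case False
    then have "j' = j \<or> j' = 1" using j j' by auto
    from weyl_roots_obtuse_aux[OF no_orth assms(4)[symmetric] this j r' r]
    show ?thesis by (simp add: lform_commute)
  qed
qed

text \<open>Completing the square gives \<open>2 j (r, v) = - (x - j y)\<^sup>2 + 2 j\<^sup>2 (y\<^sup>2 / 2 - n) + 2 j\<close> for
  \<open>r = (x, j, b)\<close> and \<open>v = (y, 1, n)\<close>, and \<open>j \<ge> 1\<close>.\<close>
lemma weyl_root_neg_on_horoball:
  assumes "r \<in> weyl_roots" and n: "n > 1 + (y \<bullet> y) / 2"
  shows "lform r (y, 1, n) < 0"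
proof -
  obtain j where j: "j = 1 \<or> j = real N" and r: "lform r r = 2 * j" "lform r weyl_rho = - j"
    using assms(1) by (rule weyl_roots_obtain) (rule that, assumption+)
  obtain x b where r_eq: "r = (x, j, b)"
    using r(2) by (cases r) (simp add: lform_rho_Pair)
  have "j \<ge> 1" using j prime_ge_1_nat[OF prime_N] by auto
  have b: "2 * j * b = x \<bullet> x - 2 * j" using r(1) by (simp add: r_eq lform_Pair algebra_simps)
  have "0 \<le> (x - j *\<^sub>R y) \<bullet> (x - j *\<^sub>R y)" by simp
  also have "\<dots> = x \<bullet> x - 2 * j * (x \<bullet> y) + j * j * (y \<bullet> y)"
    by (simp add: algebra_simps inner_commute)
  finally have 1: "2 * j * (x \<bullet> y) \<le> x \<bullet> x + j * j * (y \<bullet> y)" by simp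
  have "2 * j * lform r (y, 1, n) = 2 * j * (x \<bullet> y) - 2 * j * j * n - 2 * j * b"
    by (simp add: r_eq lform_Pair algebra_simps)
  also have "\<dots> \<le> j * j * (y \<bullet> y) - 2 * j * j * n + 2 * j"
    using 1 b by simp
  also have "\<dots> = 2 * j * j * ((y \<bullet> y) / 2 - n) + 2 * j" by (simp add: algebra_simps)
  also have "\<dots> < 2 * j * j * (- 1) + 2 * j"
    using n \<open>j \<ge> 1\<close> by (intro add_strict_right_mono mult_strict_left_mono) auto
  also have "\<dots> = 2 * j * (1 - j)" by (simp add: algebra_simps)
  also have "\<dots> \<le> 0" using \<open>j \<ge> 1\<close> by (simp add: mult_le_0_iff)
  finally show ?thesis using \<open>j \<ge> 1\<close> by (simp add: mult_less_0_iff)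
qed

section \<open>The chamber around the Weyl vector\<close>

lemma simple_roots_subset_weyl:
  assumes "weyl_vector L C weyl_rho"
  shows "simple_roots L C \<subseteq> weyl_roots"
proof
  fix r assume r: "r \<in> simple_roots L C"
  then have "is_root L r" by (simp add: simple_roots_def)
  moreover have "lform r weyl_rho = - lform r r / 2"
    using assms r unfolding weyl_vector_def by (rule bspec)
  ultimately show "r \<in> weyl_roots" by (simp add: weyl_roots_def)
qed

lemma horoball_in_V:
  assumes "x \<in> S" shows "(t *\<^sub>R x, 1, n) \<in> V"
proof -
  have "(x, 0, 0) \<in> L" "(0, 1, 0) \<in> L" "(0, 0, 1) \<in> L"
    using assms by (simp_all add: L_iff zero_mem)
  then have "t *\<^sub>R (x, 0, 0) + (0, 1, 0) + n *\<^sub>R (0, 0, 1) \<in> V"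
    by (intro span_add span_mul span_base)
  then show ?thesis by simp
qed

lemma future_chamber_horoball:
  assumes C: "weyl_chamber L C" and rho: "weyl_vector L C weyl_rho"
    and v\<^sub>0: "v\<^sub>0 \<in> C" "lform v\<^sub>0 weyl_rho < 0"
    and x: "x \<in> S" and n: "n > 1 + ((t *\<^sub>R x) \<bullet> (t *\<^sub>R x)) / 2"
  shows "(t *\<^sub>R x, 1, n) \<in> C"
proof (rule ccontr)
  assume out: "(t *\<^sub>R x, 1, n) \<notin> C"
  have "lform (t *\<^sub>R x, 1, n) (t *\<^sub>R x, 1, n) < 0" using n by (simp add: lform_Pair)
  then have cone: "(t *\<^sub>R x, 1, n) \<in> time_cone (lform v\<^sub>0 weyl_rho)"
    using v\<^sub>0(2) by (simp add: time_cone_def lform_rho_Pair)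
  obtain r where r: "r \<in> simple_roots L C" "lform r (t *\<^sub>R x, 1, n) \<ge> 0"
    by (rule chamber_separated_by_simple_root[OF C v\<^sub>0(1) horoball_in_V[OF x] cone out])
  have "r \<in> weyl_roots" using simple_roots_subset_weyl[OF rho] r(1) by (rule subsetD)
  from weyl_root_neg_on_horoball[OF this n] r(2) show False by simp
qed

text \<open>The mirror of a root orthogonal to \<open>\<rho>\<close> is invariant under adding multiples of \<open>\<rho>\<close>, so it
  reaches the horoball, which lies inside the chamber.\<close>
lemma future_chamber_no_orthogonal_root:
  assumes C: "weyl_chamber L C" and rho: "weyl_vector L C weyl_rho"
    and v\<^sub>0: "v\<^sub>0 \<in> C" "lform v\<^sub>0 weyl_rho < 0" and s: "is_root L s"
  shows "lform s weyl_rho \<noteq> 0"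
proof
  assume "lform s weyl_rho = 0"
  then obtain x b where s_eq: "s = (x, 0, b)"
    by (cases s) (simp add: lform_rho_Pair)
  have "x \<in> S" using root_mem[OF s] by (simp add: s_eq L_iff)
  have "x \<bullet> x > 0" using root_pos[OF s] by (simp add: s_eq lform_Pair)
  \<comment> \<open>With \<open>s = (x, 0, b)\<close>, this multiple of \<open>x\<close> has product
    \<open>b\<close> with \<open>x\<close>, which puts the point on the mirror.\<close>
  let ?t = "b / (x \<bullet> x)" and ?n = "2 + ((b / (x \<bullet> x)) *\<^sub>R x) \<bullet> ((b / (x \<bullet> x)) *\<^sub>R x) / 2"
  have "(?t *\<^sub>R x, 1, ?n) \<in> C"
    by (rule future_chamber_horoball[OF C rho v\<^sub>0 \<open>x \<in> S\<close>]) simp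
  from chamber_subset(3)[OF C this s] show False
    using \<open>x \<bullet> x > 0\<close> by (simp add: s_eq lform_Pair)
qed

text \<open>Project a ball in the chamber onto the mirror of \<open>r\<close>. The projection adds a positive multiple
  of \<open>r\<close>, and all other roots in \<open>R\<close> have nonpositive product with \<open>r\<close>, so they stay negative and
  the image lies in the closure of the chamber.\<close>
lemma future_chamber_weyl_root_simple:
  assumes C: "weyl_chamber L C" and rho: "weyl_vector L C weyl_rho"
    and v\<^sub>0: "v\<^sub>0 \<in> C" "lform v\<^sub>0 weyl_rho < 0" and r: "r \<in> weyl_roots"
  shows "r \<in> simple_roots L C"
proof -
  have root: "is_root L r" and r_rho: "lform r weyl_rho = - lform r r / 2"
    using r by (simp_all add: weyl_roots_def)
  have rr: "lform r r > 0" by (rule root_pos[OF root])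
  have sub: "C \<subseteq> V" by (rule chamber_subset(1)[OF C])
  have h: "(0, 1, 2) \<in> C"
    using future_chamber_horoball[OF C rho v\<^sub>0 zero_mem, where t = 0 and n = 2] by simp
  have "lform r (0, 1, 2) < 0" by (rule weyl_root_neg_on_horoball[OF r]) simp
  then have neg: "lform r v < 0" if "v \<in> C" for v
    using chamber_same_sign[OF C h that root] by (simp add: zero_less_mult_iff)
  have future: "lform v weyl_rho < 0" if "v \<in> C" for v
    using chamber_time_cone[OF C v\<^sub>0(1) that] v\<^sub>0(2) by (simp add: time_cone_def zero_less_mult_iff)
  obtain d where d: "d > 0" "ball v\<^sub>0 d \<inter> V \<subseteq> C" by (rule chamber_open[OF C v\<^sub>0(1)])
  define c where "c = lform r v\<^sub>0 / lform r r"
  have "c < 0" using neg[OF v\<^sub>0(1)] rr by (simp add: c_def divide_neg_pos)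
  define q where "q = v\<^sub>0 - c *\<^sub>R r"
  have qV: "q \<in> V" using subsetD[OF sub v\<^sub>0(1)] root_mem_V[OF root]
    by (simp add: q_def span_diff span_mul)
  have rq: "lform r q = 0" using rr by (simp add: q_def lform_simps c_def)
  have wall: "u \<in> closure C" if u: "u \<in> ball q d" "u \<in> V" "lform r u = 0" for u
  proof -
    define y where "y = u + c *\<^sub>R r"
    have "dist v\<^sub>0 y = dist q u" by (simp add: dist_norm q_def y_def algebra_simps)
    then have "y \<in> ball v\<^sub>0 d" using u(1) by simp
    moreover have "y \<in> V" using u(2) root_mem_V[OF root] by (simp add: y_def span_add span_mul)
    ultimately have yC: "y \<in> C" using d(2) by (simp add: subset_eq)
    have y_norm: "lform y y = lform u u + c\<^sup>2 * lform r r"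
      using u(3) by (simp add: y_def lform_simps lform_commute[of u r] power2_eq_square algebra_simps)
    show ?thesis
    proof (rule closure_if_segment[of u y])
      fix t :: real assume t: "0 < t" "t \<le> 1"
      define z where "z = u + t *\<^sub>R (y - u)"
      have z: "z = u + (t * c) *\<^sub>R r" by (simp add: z_def y_def)
      have zV: "z \<in> V" using u(2) root_mem_V[OF root] by (simp add: z span_add span_mul)
      have "lform z z = lform u u + t\<^sup>2 * (c\<^sup>2 * lform r r)"
        using u(3) by (simp add: z lform_simps lform_commute[of u r] power2_eq_square algebra_simps)
      also have "\<dots> \<le> lform u u + 1 * (c\<^sup>2 * lform r r)"
        using t rr by (intro add_left_mono mult_right_mono) (auto simp: power_le_one)
      also have "\<dots> < 0" using chamber_subset(2)[OF C yC] y_norm by simp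
      finally have zz: "lform z z < 0" .
      have "lform z weyl_rho = lform y weyl_rho - ((1 - t) * c) * lform r weyl_rho"
        by (simp add: z y_def lform_simps algebra_simps)
      moreover have "(1 - t) * c \<le> 0" using t \<open>c < 0\<close> by (simp add: mult_nonneg_nonpos)
      then have "((1 - t) * c) * lform r weyl_rho \<ge> 0" using r_rho rr by (intro mult_nonpos_nonpos) auto
      ultimately have "lform z weyl_rho < 0" using future[OF yC] by simp
      then have cone: "z \<in> time_cone (lform v\<^sub>0 weyl_rho)"
        using zz v\<^sub>0(2) by (simp add: time_cone_def mult_neg_neg)
      have "z \<in> C"
      proof (rule ccontr)
        assume "z \<notin> C"
        obtain s where s: "s \<in> simple_roots L C" "lform s z \<ge> 0"
          by (rule chamber_separated_by_simple_root[OF C v\<^sub>0(1) zV cone \<open>z \<notin> C\<close>])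
        have sy: "lform s y < 0" by (rule simple_root_neg(2)[OF C s(1) yC])
        have "lform s u \<le> 0"
        proof (cases "s = r")
          case True then show ?thesis using u(3) by simp
        next
          case False
          have "s \<in> weyl_roots" using simple_roots_subset_weyl[OF rho] s(1) by (rule subsetD)
          then have "lform s r \<le> 0"
            by (intro weyl_roots_obtuse[OF future_chamber_no_orthogonal_root[OF C rho v\<^sub>0] _ r False])
          then have "c * lform s r \<ge> 0" using \<open>c < 0\<close> by (simp add: mult_nonpos_nonpos)
          then show ?thesis using sy by (simp add: y_def lform_simps)
        qed
        then have "(1 - t) * lform s u \<le> 0" using t by (simp add: mult_nonneg_nonpos)
        moreover have "t * lform s y < 0" using t sy by (simp add: mult_pos_neg)
        moreover have "lform s z = (1 - t) * lform s u + t * lform s y"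
          by (simp add: z_def lform_simps algebra_simps)
        ultimately show False using s(2) by simp
      qed
      then show "u + t *\<^sub>R (y - u) \<in> C" by (simp add: z_def)
    qed
  qed
  show ?thesis
    by (rule simple_root_if_wall[OF root sub chamber_convex[OF C] _ v\<^sub>0(1) d qV rq d(1)])
       (rule neg, assumption, rule wall, assumption+)
qed

section \<open>The opposite half of the light cone\<close>

lemma chamber_scale:
  assumes C: "weyl_chamber L C" and "v \<in> C" "t > 0" shows "t *\<^sub>R v \<in> C"
  using chamber_cell_scale[of v L v t] weyl_chamber_eq_cell[OF C \<open>v \<in> C\<close>] assms by simp

text \<open>The chamber is an open cone in the span of the lattice: far enough along a ray inside it,
  rounding the coordinates with respect to lattice vectors does not leave it.\<close>
lemma chamber_lattice_point:
  assumes C: "weyl_chamber L C" and v: "v \<in> C"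
  obtains y where "y \<in> C" "y \<in> L"
proof -
  obtain d where d: "d > 0" "ball v d \<inter> V \<subseteq> C" by (rule chamber_open[OF C v])
  have "v \<in> V" using chamber_subset(1)[OF C] v by (rule subsetD)
  then have "\<exists>T c. v = (\<Sum>a\<in>T. c a *\<^sub>R a) \<and> finite T \<and> T \<subseteq> L"
    unfolding span_explicit by simp
  then obtain T c where T: "finite T" "T \<subseteq> L" and v_eq: "v = (\<Sum>a\<in>T. c a *\<^sub>R a)"
    by (elim exE conjE) (rule that)
  define K where "K = (\<Sum>a\<in>T. norm a) / d + 1"
  have "K > 0" using d(1) by (simp add: K_def add_nonneg_pos sum_nonneg)
  define y where "y = (\<Sum>a\<in>T. of_int \<lfloor>K * c a\<rfloor> *\<^sub>R a)"
  have yL: "y \<in> L" unfolding y_def using T(2) by (intro L_sum L_of_int) (rule subsetD)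
  have "K *\<^sub>R v - y = (\<Sum>a\<in>T. (K * c a - of_int \<lfloor>K * c a\<rfloor>) *\<^sub>R a)"
    by (simp add: v_eq y_def scaleR_sum_right scaleR_diff_left sum_subtractf)
  also have "norm \<dots> \<le> (\<Sum>a\<in>T. norm a)"
  proof (rule order_trans[OF norm_sum sum_mono])
    fix a
    have "\<bar>K * c a - of_int \<lfloor>K * c a\<rfloor>\<bar> \<le> 1" by linarith
    then show "norm ((K * c a - of_int \<lfloor>K * c a\<rfloor>) *\<^sub>R a) \<le> norm a"
      by (simp add: mult_left_le_one_le)
  qed
  also have "\<dots> < K * d" using d(1) by (simp add: K_def algebra_simps)
  finally have close: "norm (K *\<^sub>R v - y) < K * d" .
  have "K *\<^sub>R (v - (1 / K) *\<^sub>R y) = K *\<^sub>R v - y" using \<open>K > 0\<close> by (simp add: scaleR_diff_right)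
  then have "K * norm (v - (1 / K) *\<^sub>R y) < K * d"
    using close \<open>K > 0\<close> by (metis abs_of_pos norm_scaleR)
  then have "(1 / K) *\<^sub>R y \<in> ball v d" using \<open>K > 0\<close> by (simp add: dist_norm)
  moreover have "(1 / K) *\<^sub>R y \<in> V" using yL by (intro span_mul span_base)
  ultimately have "(1 / K) *\<^sub>R y \<in> C" using d(2) by (simp add: subset_eq)
  from chamber_scale[OF C this \<open>K > 0\<close>] have "y \<in> C" using \<open>K > 0\<close> by simp
  with yL show thesis using that by blast
qed

text \<open>The norm \<open>2\<close> vectors \<open>(l, 1, l\<^sup>2 / 2 - 1)\<close> with \<open>l = e, -e, 0\<close> combine to a nonzero multiple
  of \<open>\<rho>\<close>, which is not orthogonal to \<open>z\<close>, so they cannot all be orthogonal to \<open>z\<close>; the sign is adjusted by negation.\<close>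
lemma norm_two_vector_neg:
  assumes "lform z weyl_rho \<noteq> 0"
  obtains s where "s \<in> L" "lform s s = 2" "lform s z < 0"
proof -
  obtain e where e: "e \<in> S" "e \<noteq> 0" using nontrivial by blast
  define f where "f l = (l, 1::real, (l \<bullet> l) / 2 - 1)" for l :: "real^24"
  have f: "f l \<in> L" "lform (f l) (f l) = 2" if "l \<in> S" for l
    using norm_2_family_root[OF that] by (simp_all add: f_def)
  have "f e + f (- e) - 2 *\<^sub>R f 0 = (e \<bullet> e) *\<^sub>R weyl_rho"
    by (simp add: f_def weyl_rho_def)
  then have "lform (f e) z + lform (f (- e)) z - 2 * lform (f 0) z = (e \<bullet> e) * lform z weyl_rho"
    by (metis lform.add_left lform.diff_left lform.scaleR_left lform_commute real_scaleR_def)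
  moreover have "(e \<bullet> e) * lform z weyl_rho \<noteq> 0" using e(2) assms by simp
  ultimately have "lform (f e) z \<noteq> 0 \<or> lform (f (- e)) z \<noteq> 0 \<or> lform (f 0) z \<noteq> 0" by auto
  then have "\<exists>l\<in>S. lform (f l) z \<noteq> 0"
    using e(1) minus_mem[OF e(1)] zero_mem by blast
  then obtain l where l: "l \<in> S" "lform (f l) z \<noteq> 0" by (rule bexE)
  show thesis
  proof (cases "lform (f l) z < 0")
    case True with f[OF l(1)] show thesis by (rule that)
  next
    case False
    show thesis
      by (rule that[of "- f l"]) (use False f[OF l(1)] l(2) in \<open>simp_all add: L_minus lform_simps\<close>)
  qed
qed

text \<open>Starting from a lattice point \<open>y\<close> of \<open>C\<close>, the ray \<open>y + t \<rho>\<close> runs inside \<open>C\<close> up to the null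
  vector \<open>z\<^sub>0\<close>, because simple roots have negative product with \<open>\<rho>\<close>. For the same reason \<open>C\<close>
  contains all negative norm vectors of the span of \<open>L\<close> near \<open>z\<^sub>0\<close>. The roots
  \<open>s\<^sub>k = s - k c e + (k a - k\<^sup>2 (e\<^sup>2 / 2) c) z\<close>, with \<open>c = (s, z)\<close>, \<open>a = (s, e)\<close> and \<open>e\<close> orthogonal to
  the null lattice vector \<open>z\<close>, are the images of \<open>s\<close> under powers of an Eichler transvection. Their
  directions converge to \<open>z\<close>, so \<open>s\<^sub>k\<close> is negative at \<open>y\<close> for large \<open>k\<close>, but it is positive at a
  point of negative norm near \<open>z\<^sub>0\<close>: its mirror cuts \<open>C\<close>.\<close>
lemma past_chamber_impossible:
  assumes C: "weyl_chamber L C" and rho: "weyl_vector L C weyl_rho"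
    and v\<^sub>0: "v\<^sub>0 \<in> C" "lform v\<^sub>0 weyl_rho > 0"
  shows False
proof -
  obtain y where y: "y \<in> C" "y \<in> L" by (rule chamber_lattice_point[OF C v\<^sub>0(1)])
  define \<kappa> where "\<kappa> = lform y weyl_rho"
  have "\<kappa> > 0" using chamber_time_cone[OF C v\<^sub>0(1) y(1)] v\<^sub>0(2)
    by (simp add: \<kappa>_def time_cone_def zero_less_mult_iff)
  have yy: "lform y y < 0" by (rule chamber_subset(2)[OF C y(1)])
  have y_cone: "y \<in> time_cone \<kappa>" using yy \<open>\<kappa> > 0\<close> by (simp add: time_cone_def \<kappa>_def)
  have rhoV: "weyl_rho \<in> V" by (rule span_base[OF rho_mem])
  have up: "v + t *\<^sub>R weyl_rho \<in> C"
    if v: "v \<in> C" and t: "t > 0" and tl: "lform (v + t *\<^sub>R weyl_rho) (v + t *\<^sub>R weyl_rho) < 0" for v t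
  proof (rule ccontr)
    assume out: "v + t *\<^sub>R weyl_rho \<notin> C"
    have V: "v + t *\<^sub>R weyl_rho \<in> V"
      using subsetD[OF chamber_subset(1)[OF C] v] rhoV by (intro span_add span_mul)
    have "lform v weyl_rho * lform v weyl_rho > 0"
      using chamber_time_cone[OF C v v] by (simp add: time_cone_def)
    then have cone: "v + t *\<^sub>R weyl_rho \<in> time_cone (lform v weyl_rho)"
      using tl by (simp add: time_cone_def lform_simps lform_rho_rho)
    obtain s where s: "s \<in> simple_roots L C" "lform s (v + t *\<^sub>R weyl_rho) \<ge> 0"
      by (rule chamber_separated_by_simple_root[OF C v V cone out])
    have "s \<in> weyl_roots" using simple_roots_subset_weyl[OF rho] s(1) by (rule subsetD)
    then have "lform s weyl_rho < 0"
      using root_pos[of s] by (simp add: weyl_roots_def)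
    then have "t * lform s weyl_rho < 0" using t by (simp add: mult_pos_neg)
    then show False using s(2) simple_root_neg(2)[OF C s(1) v] by (simp add: lform_simps)
  qed
  define t\<^sub>0 where "t\<^sub>0 = - lform y y / (2 * \<kappa>)"
  have "t\<^sub>0 > 0" using yy \<open>\<kappa> > 0\<close> by (simp add: t\<^sub>0_def divide_neg_pos)
  define z\<^sub>0 where "z\<^sub>0 = y + t\<^sub>0 *\<^sub>R weyl_rho"
  define z where "z = (2 * \<kappa>) *\<^sub>R y - lform y y *\<^sub>R weyl_rho"
  have z_eq: "z = (2 * \<kappa>) *\<^sub>R z\<^sub>0"
    using \<open>\<kappa> > 0\<close> by (simp add: z_def z\<^sub>0_def t\<^sub>0_def scaleR_diff_right)
  have "\<kappa> \<in> \<int>" unfolding \<kappa>_def by (rule lform_Ints[OF y(2) rho_mem])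
  then have zL: "z \<in> L" unfolding z_def
    using lform_Ints[OF y(2) y(2)] y(2) rho_mem by (intro L_diff L_Ints) auto
  have zz: "lform z z = 0"
    by (simp add: z_def lform_simps lform_rho_rho lform_commute[of weyl_rho y] flip: \<kappa>_def)
  have z_rho: "lform z weyl_rho = 2 * \<kappa> * \<kappa>"
    by (simp add: z_def lform_simps lform_rho_rho flip: \<kappa>_def)
  then have z_rho_pos: "lform z weyl_rho > 0" using \<open>\<kappa> > 0\<close> by simp
  have zy: "lform z y < 0"
    using time_cone_product[OF y_cone, of z] zz z_rho_pos \<open>\<kappa> > 0\<close>
    by (simp add: lform_commute[of z y])
  obtain d where d: "d > 0" "ball y d \<inter> V \<subseteq> C" by (rule chamber_open[OF C y(1)])
  have near: "u \<in> C" if u: "u \<in> V" "dist u z\<^sub>0 < d" "lform u u < 0" for u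
  proof -
    have "dist y (u - t\<^sub>0 *\<^sub>R weyl_rho) = dist u z\<^sub>0"
      by (simp add: dist_norm z\<^sub>0_def norm_minus_commute algebra_simps)
    then have "u - t\<^sub>0 *\<^sub>R weyl_rho \<in> ball y d" using u(2) by simp
    moreover have "u - t\<^sub>0 *\<^sub>R weyl_rho \<in> V" using u(1) rhoV by (intro span_diff span_mul)
    ultimately have "u - t\<^sub>0 *\<^sub>R weyl_rho \<in> C" using d(2) by (simp add: subset_eq)
    from up[OF this \<open>t\<^sub>0 > 0\<close>] u(3) show ?thesis by simp
  qed
  have "lform z weyl_rho \<noteq> 0" using z_rho_pos by simp
  then obtain s where s: "s \<in> L" "lform s s = 2" "lform s z < 0"
    by (rule norm_two_vector_neg)
  obtain e\<^sub>0 where e\<^sub>0: "e\<^sub>0 \<in> S" "e\<^sub>0 \<noteq> 0" using nontrivial by blast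
  obtain l m n where y_eq: "y = (l, m, n)" by (cases y)
  have m: "m = - \<kappa>" by (simp add: \<kappa>_def y_eq lform_rho_Pair)
  \<comment> \<open>A lattice vector of positive norm orthogonal to both \<open>y\<close> and
    \<open>\<rho>\<close>, hence to \<open>z\<close>.\<close>
  define e where "e = (m *\<^sub>R e\<^sub>0, 0::real, e\<^sub>0 \<bullet> l)"
  have "l \<in> S" "m \<in> \<int>" using y(2) by (simp_all add: y_eq L_iff)
  have eL: "e \<in> L"
  proof -
    have "(e\<^sub>0, 0, 0) \<in> L" using e\<^sub>0(1) by (simp add: L_iff)
    from L_Ints[OF this \<open>m \<in> \<int>\<close>] have "m *\<^sub>R e\<^sub>0 \<in> S" by (simp add: L_iff)
    then show ?thesis using inner_Ints[OF e\<^sub>0(1) \<open>l \<in> S\<close>] by (simp add: e_def L_iff)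
  qed
  have ez: "lform e z = 0"
  proof -
    have "lform e y = 0" "lform e weyl_rho = 0"
      by (simp_all add: e_def y_eq lform_Pair lform_rho_Pair)
    then show ?thesis by (simp add: z_def lform_simps)
  qed
  have ee: "lform e e > 0"
    using e\<^sub>0(2) m \<open>\<kappa> > 0\<close> by (simp add: e_def lform_Pair)
  obtain E :: int where E: "lform e e = 2 * of_int E" using lform_even[OF eL] by blast
  define c a where "c = lform s z" and "a = lform s e"
  have ca: "c \<in> \<int>" "a \<in> \<int>" using lform_Ints s(1) zL eL by (simp_all add: c_def a_def)
  define \<alpha> where "\<alpha> = - of_int E * c"
  have "\<alpha> > 0" using ee E s(3) by (simp add: \<alpha>_def c_def mult_pos_neg)
  \<comment> \<open>\<open>X (1 / k) = s\<^sub>k / k\<^sup>2\<close>: rescaled so that the limit as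
    \<open>h\<close> tends to \<open>0\<close> exists.\<close>
  define X where "X h = h\<^sup>2 *\<^sub>R s - (h * c) *\<^sub>R e + (h * a + \<alpha>) *\<^sub>R z" for h :: real
  have X_norm: "lform (X h) (X h) = 2 * h ^ 4" for h
    unfolding X_def
    by (simp add: lform_simps s(2) E zz ez lform_commute[of z s] lform_commute[of z e] lform_commute[of e s]
          flip: c_def a_def)
       (simp add: \<alpha>_def algebra_simps power2_eq_square power4_eq_xxxx)
  have X_root: "is_root L ((1 / h\<^sup>2) *\<^sub>R X h)" if h: "h = 1 / real (Suc k)" for h k
  proof (rule norm_two_root)
    have "h > 0" "1 / h \<in> \<int>" using h by simp_all
    have "(1 / h\<^sup>2) *\<^sub>R X h = s - (1 / h * c) *\<^sub>R e + (1 / h * a + (1 / h) * (1 / h) * \<alpha>) *\<^sub>R z"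
      unfolding X_def using \<open>h > 0\<close>
      by (simp add: scaleR_add_right scaleR_diff_right power2_eq_square algebra_simps)
    also have "\<dots> \<in> L"
      using s(1) eL zL ca \<open>1 / h \<in> \<int>\<close> unfolding \<alpha>_def
      by (intro L_add L_diff L_Ints Ints_mult Ints_add Ints_minus Ints_of_int)
    finally show "(1 / h\<^sup>2) *\<^sub>R X h \<in> L" .
    show "lform ((1 / h\<^sup>2) *\<^sub>R X h) ((1 / h\<^sup>2) *\<^sub>R X h) = 2"
      using \<open>h > 0\<close> by (simp add: lform_simps X_norm power2_eq_square power4_eq_xxxx)
  qed
  define H where "H k = 1 / real (Suc k)" for k
  have H_lim: "H \<longlonglongrightarrow> 0" unfolding H_def by (rule LIMSEQ_Suc[OF lim_1_over_n])
  have "(\<lambda>k. X (H k)) \<longlonglongrightarrow> 0\<^sup>2 *\<^sub>R s - (0 * c) *\<^sub>R e + (0 * a + \<alpha>) *\<^sub>R z"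
    unfolding X_def by (intro tendsto_intros H_lim)
  then have X_lim: "(\<lambda>k. X (H k)) \<longlonglongrightarrow> \<alpha> *\<^sub>R z" by simp
  have g_lim: "(\<lambda>k. lform (X (H k)) weyl_rho) \<longlonglongrightarrow> \<alpha> * lform z weyl_rho"
    using lform.tendsto[OF X_lim tendsto_const[of weyl_rho]] by (simp add: lform_simps)
  have g_pos: "\<alpha> * lform z weyl_rho > 0" using \<open>\<alpha> > 0\<close> z_rho_pos by simp
  \<comment> \<open>The vector \<open>X h + t \<rho>\<close>, with \<open>X h\<close> of norm \<open>2
    h\<^sup>4\<close> and \<open>g = (X h, \<rho>) > 0\<close>, has norm \<open>2 h\<^sup>4 + 2 t
    g\<close> and product \<open>2 h\<^sup>4 + t g\<close> with \<open>X h\<close>; \<open>t = - 3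
    h\<^sup>4 / (2 g)\<close> makes the first negative and the second positive.\<close>
  define Q where "Q k = X (H k) - (3 * H k ^ 4 / (2 * lform (X (H k)) weyl_rho)) *\<^sub>R weyl_rho" for k
  have "Q \<longlonglongrightarrow> \<alpha> *\<^sub>R z - (3 * 0 ^ 4 / (2 * (\<alpha> * lform z weyl_rho))) *\<^sub>R weyl_rho"
    unfolding Q_def by (intro tendsto_intros X_lim H_lim g_lim) (use g_pos in auto)
  then have "(\<lambda>k. (1 / (2 * \<kappa> * \<alpha>)) *\<^sub>R Q k) \<longlonglongrightarrow> (1 / (2 * \<kappa> * \<alpha>)) *\<^sub>R (\<alpha> *\<^sub>R z)"
    by (intro tendsto_intros) simp
  moreover have "(1 / (2 * \<kappa> * \<alpha>)) *\<^sub>R (\<alpha> *\<^sub>R z) = z\<^sub>0"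
    using \<open>\<kappa> > 0\<close> \<open>\<alpha> > 0\<close> by (simp add: z_eq)
  ultimately have Q_lim: "(\<lambda>k. (1 / (2 * \<kappa> * \<alpha>)) *\<^sub>R Q k) \<longlonglongrightarrow> z\<^sub>0" by simp
  have "(\<lambda>k. lform (X (H k)) y) \<longlonglongrightarrow> \<alpha> * lform z y"
    using lform.tendsto[OF X_lim tendsto_const[of y]] by (simp add: lform_simps)
  moreover have "\<alpha> * lform z y < 0" using \<open>\<alpha> > 0\<close> zy by (simp add: mult_pos_neg)
  ultimately have "\<forall>\<^sub>F k in sequentially. lform (X (H k)) y < 0" by (rule order_tendstoD(2))
  moreover have "\<forall>\<^sub>F k in sequentially. dist ((1 / (2 * \<kappa> * \<alpha>)) *\<^sub>R Q k) z\<^sub>0 < d"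
    by (rule tendstoD[OF Q_lim d(1)])
  moreover have "\<forall>\<^sub>F k in sequentially. lform (X (H k)) weyl_rho > 0"
    by (rule order_tendstoD(1)[OF g_lim g_pos])
  ultimately have "\<forall>\<^sub>F k in sequentially. lform (X (H k)) y < 0 \<and>
      dist ((1 / (2 * \<kappa> * \<alpha>)) *\<^sub>R Q k) z\<^sub>0 < d \<and> lform (X (H k)) weyl_rho > 0"
    by (intro eventually_conj)
  from eventually_happens'[OF sequentially_bot this]
  obtain k where k: "lform (X (H k)) y < 0"
      "dist ((1 / (2 * \<kappa> * \<alpha>)) *\<^sub>R Q k) z\<^sub>0 < d" "lform (X (H k)) weyl_rho > 0"
    by (elim exE conjE) (rule that)
  define h g where "h = H k" and "g = lform (X h) weyl_rho"
  have "h > 0" "g > 0" using k(3) by (simp_all add: h_def H_def g_def)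
  have Q: "Q k = X h - (3 * h ^ 4 / (2 * g)) *\<^sub>R weyl_rho" by (simp add: Q_def h_def g_def)
  have QQ: "lform (Q k) (Q k) = - (h ^ 4)"
    using \<open>g > 0\<close> by (simp add: Q lform_simps X_norm lform_rho_rho lform_commute[of weyl_rho "X h"] flip: g_def)
  have XQ: "lform (X h) (Q k) = h ^ 4 / 2"
    using \<open>g > 0\<close> by (simp add: Q lform_simps X_norm flip: g_def)
  let ?b = "1 / (2 * \<kappa> * \<alpha>)"
  have b: "?b > 0" using \<open>\<kappa> > 0\<close> \<open>\<alpha> > 0\<close> by simp
  have XV: "X h \<in> V" unfolding X_def
    using s(1) eL zL by (intro span_add span_diff span_mul span_base)
  have "?b *\<^sub>R Q k \<in> C"
  proof (rule near[OF _ k(2)])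
    show "?b *\<^sub>R Q k \<in> V" unfolding Q using XV rhoV by (intro span_mul span_diff)
    have "?b * ?b * (h ^ 4) > 0" using b \<open>h > 0\<close> by (intro mult_pos_pos zero_less_power)
    then show "lform (?b *\<^sub>R Q k) (?b *\<^sub>R Q k) < 0" by (simp add: lform_simps QQ)
  qed
  from chamber_same_sign[OF C y(1) this X_root[of h k]]
  have "lform ((1 / h\<^sup>2) *\<^sub>R X h) y * lform ((1 / h\<^sup>2) *\<^sub>R X h) (?b *\<^sub>R Q k) > 0"
    by (simp add: h_def H_def)
  moreover have "lform ((1 / h\<^sup>2) *\<^sub>R X h) y < 0"
    using k(1) \<open>h > 0\<close> by (simp add: lform_simps divide_neg_pos flip: h_def)
  moreover have "lform ((1 / h\<^sup>2) *\<^sub>R X h) (?b *\<^sub>R Q k) > 0"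
    unfolding lform_simps XQ real_scaleR_def using b \<open>h > 0\<close> by (intro mult_pos_pos) auto
  ultimately show False by (simp add: zero_less_mult_iff)
qed

lemma simple_roots_eq_weyl_roots:
  assumes C: "weyl_chamber L C" and rho: "weyl_vector L C weyl_rho"
  shows "simple_roots L C = weyl_roots"
proof
  show "simple_roots L C \<subseteq> weyl_roots" by (rule simple_roots_subset_weyl[OF rho])
  have "C \<noteq> {}" using C[unfolded weyl_chamber_def] by (rule in_components_nonempty)
  then obtain v where v: "v \<in> C" using ex_in_conv by metis
  have "lform v weyl_rho \<noteq> 0" by (rule timelike_rho_nonzero[OF chamber_subset(2)[OF C v]])
  then have future: "lform v weyl_rho < 0"
    using past_chamber_impossible[OF C rho v] by (metis linorder_neqE_linordered_idom)
  show "weyl_roots \<subseteq> simple_roots L C"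
    using future_chamber_weyl_root_simple[OF C rho v future] by (rule subsetI)
qed

end

section \<open>Fixed sublattices of even unimodular lattices\<close>

lemma poly_det: "poly (det A) x = det (\<chi> i j. poly (A $ i $ j) x)"
  for A :: "real poly^'n^'n"
  by (simp add: det_def poly_sum poly_prod)

definition orbit_sum :: "('a::real_vector \<Rightarrow> 'a) \<Rightarrow> nat \<Rightarrow> 'a \<Rightarrow> 'a" where
  "orbit_sum \<sigma> N x = (\<Sum>i<N. (\<sigma> ^^ i) x)"

lemma linear_funpow:
  fixes \<sigma> :: "'a::real_vector \<Rightarrow> 'a"
  shows "linear \<sigma> \<Longrightarrow> linear (\<sigma> ^^ i)"
  by (induction i) (simp_all only: funpow.simps linear_id linear_compose)

lemma linear_orbit_sum: "linear \<sigma> \<Longrightarrow> linear (orbit_sum \<sigma> N)"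
  unfolding orbit_sum_def by (intro linear_compose_sum ballI linear_funpow)

lemma orbit_sum_fixed:
  assumes "linear \<sigma>" "(\<sigma> ^^ N) = id"
  shows "\<sigma> (orbit_sum \<sigma> N x) = orbit_sum \<sigma> N x"
proof -
  have "\<sigma> (orbit_sum \<sigma> N x) = (\<Sum>i<N. (\<sigma> ^^ Suc i) x)"
    by (simp add: orbit_sum_def linear_sum[OF assms(1)])
  also have "(\<Sum>i<N. (\<sigma> ^^ Suc i) x) + (\<sigma> ^^ 0) x = (\<Sum>i<Suc N. (\<sigma> ^^ i) x)"
    by (simp only: sum.lessThan_Suc_shift add.commute)
  then have "(\<Sum>i<N. (\<sigma> ^^ Suc i) x) = orbit_sum \<sigma> N x"
    using assms(2) by (simp add: orbit_sum_def)
  finally show ?thesis .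
qed

lemma funpow_fixed: "\<sigma> w = w \<Longrightarrow> (\<sigma> ^^ i) w = w"
  by (induction i) auto

lemma orbit_sum_of_fixed: "\<sigma> w = w \<Longrightarrow> orbit_sum \<sigma> N w = real N *\<^sub>R w"
  by (simp add: orbit_sum_def funpow_fixed scaleR_conv_of_real sum_constant_scaleR)

text \<open>Because \<open>w\<close> is fixed and \<open>\<sigma>\<close> is an isometry, \<open>w\<close> has the same inner product with every
  element of the orbit of \<open>x\<close>.\<close>
lemma inner_orbit_sum:
  assumes "orthogonal_transformation \<sigma>" "\<sigma> w = w"
  shows "w \<bullet> orbit_sum \<sigma> N x = real N * (w \<bullet> x)"
proof -
  have "w \<bullet> (\<sigma> ^^ i) x = w \<bullet> x" for i
  proof (induction i)
    case (Suc i)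
    have "w \<bullet> (\<sigma> ^^ Suc i) x = \<sigma> w \<bullet> \<sigma> ((\<sigma> ^^ i) x)" using assms(2) by simp
    also have "\<dots> = w \<bullet> (\<sigma> ^^ i) x" using assms(1) by (simp add: orthogonal_transformation_def)
    finally show ?case using Suc by simp
  qed simp
  then show ?thesis by (simp add: orbit_sum_def inner_sum_right)
qed

lemma lattice_dual_diff: "x \<in> lattice_dual S \<Longrightarrow> y \<in> lattice_dual S \<Longrightarrow> x - y \<in> lattice_dual S"
  by (simp add: lattice_dual_def span_diff inner_diff_left)

lemma lattice_dual_zero: "0 \<in> lattice_dual S"
  by (simp add: lattice_dual_def span_zero)

lemma full_lattice_span:
  fixes \<Lambda> :: "'a::euclidean_space set"
  assumes "full_lattice \<Lambda>" shows "span \<Lambda> = UNIV"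
proof -
  obtain B where B: "independent B" "span B = UNIV"
    and eq: "\<Lambda> = {(\<Sum>b\<in>B. of_int (c b) *\<^sub>R b) | c :: 'a \<Rightarrow> int. True}"
    using assms unfolding full_lattice_def by blast
  have "finite B" using B(1) by (rule independent_imp_finite)
  have "B \<subseteq> \<Lambda>"
  proof
    fix b assume "b \<in> B"
    have "(\<Sum>x\<in>B. of_int (if x = b then 1 else 0) *\<^sub>R x) = (\<Sum>x\<in>B. if x = b then x else 0)"
      by (rule sum.cong) simp_all
    then have "b = (\<Sum>x\<in>B. of_int (if x = b then 1 else 0) *\<^sub>R x)"
      using \<open>finite B\<close> \<open>b \<in> B\<close> by (simp add: sum.delta)
    then show "b \<in> \<Lambda>" unfolding eq by (intro CollectI exI conjI TrueI)
  qed
  then show ?thesis using B(2) span_mono by (metis top.extremum_uniqueI)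
qed

text \<open>The characteristic polynomial vanishes at \<open>1\<close>.\<close>
lemma cycle_shape_fixed_vector:
  fixes \<sigma> :: "real^'n \<Rightarrow> real^'n"
  assumes "linear \<sigma>" "has_cycle_shape_1_N \<sigma> N M" "M > 0"
  obtains v where "v \<noteq> 0" "\<sigma> v = v"
proof -
  have "(\<chi> i j. poly ((if i = j then [:0, 1:] else 0) - [:matrix \<sigma> $ i $ j:]) 1) = mat 1 - matrix \<sigma>"
    by (simp add: vec_eq_iff mat_def)
  then have "det (mat 1 - matrix \<sigma>) = poly (charpoly (matrix \<sigma>)) 1"
    by (simp add: charpoly_def poly_det)
  also have "\<dots> = 0"
    using assms(2,3) by (simp add: has_cycle_shape_1_N_def)
  finally have "\<not> invertible (mat 1 - matrix \<sigma>)" by (simp add: invertible_det_nz)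
  then obtain v where v: "v \<noteq> 0" "(mat 1 - matrix \<sigma>) *v v = 0"
    by (auto simp: invertible_left_inverse matrix_left_invertible_ker)
  then have "\<sigma> v = v" using assms(1)
    by (simp add: matrix_vector_mult_diff_rdistrib matrix_works)
  with v(1) show thesis by (rule that)
qed

text \<open>The level condition and the existence of a nonzero fixed lattice vector both come from orbit
  sums. They map \<open>\<Lambda>\<close> into the fixed sublattice and multiply products with fixed vectors by \<open>N\<close>,
  which gives the former. They act as \<open>N\<close> on a fixed vector of the ambient space, so they
  do not vanish on the spanning set \<open>\<Lambda>\<close>, which gives the latter.\<close>
lemma fixed_sublattice_even_prime_level:
  fixes \<Lambda> :: "(real^24) set"
  assumes N: "prime N" and full: "full_lattice \<Lambda>" and self_dual: "lattice_dual \<Lambda> = \<Lambda>"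
    and even: "\<And>v. v \<in> \<Lambda> \<Longrightarrow> \<exists>k::int. v \<bullet> v = 2 * of_int k"
    and aut: "lattice_automorphism \<Lambda> \<sigma>" and ord: "(\<sigma> ^^ N) = id"
    and fixed: "v \<noteq> 0" "\<sigma> v = v"
  shows "even_prime_level (fixed_sublattice \<sigma> \<Lambda>) N"
proof -
  let ?S = "fixed_sublattice \<sigma> \<Lambda>"
  have orth: "orthogonal_transformation \<sigma>" and img: "\<sigma> ` \<Lambda> = \<Lambda>"
    using aut by (simp_all add: lattice_automorphism_def)
  have lin: "linear \<sigma>" using orth by (rule orthogonal_transformation_linear)
  have diff: "x - y \<in> \<Lambda>" if "x \<in> \<Lambda>" "y \<in> \<Lambda>" for x y
    using lattice_dual_diff[of x \<Lambda> y] that by (simp add: self_dual)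
  have zero: "0 \<in> \<Lambda>" using lattice_dual_zero[of \<Lambda>] by (simp add: self_dual)
  have add: "x + y \<in> \<Lambda>" if "x \<in> \<Lambda>" "y \<in> \<Lambda>" for x y
    using diff[OF that(1) diff[OF zero that(2)]] by simp
  have pow: "(\<sigma> ^^ i) x \<in> \<Lambda>" if "x \<in> \<Lambda>" for i x
    using that img by (induction i) auto
  have tr: "orbit_sum \<sigma> N x \<in> ?S" if "x \<in> \<Lambda>" for x
  proof -
    have "(\<Sum>i\<in>I. (\<sigma> ^^ i) x) \<in> \<Lambda>" for I :: "nat set"
      by (induction I rule: infinite_finite_induct) (simp_all add: zero add pow that)
    then show ?thesis
      by (simp add: fixed_sublattice_def orbit_sum_fixed[OF lin ord]) (simp add: orbit_sum_def)
  qed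
  have span_fixed: "\<sigma> w = w" if "w \<in> span ?S" for w
    using that
  proof (induction rule: span_induct_alt)
    case base then show ?case by (simp add: linear_0[OF lin])
  next
    case (step c x y) then show ?case
      by (simp add: linear_add[OF lin] linear_cmul[OF lin] fixed_sublattice_def)
  qed
  show ?thesis
  proof
    show "prime N" by (rule N)
    show "0 \<in> ?S" by (simp add: fixed_sublattice_def zero linear_0[OF lin])
    show "x - y \<in> ?S" if "x \<in> ?S" "y \<in> ?S" for x y
      using that by (simp add: fixed_sublattice_def diff linear_diff[OF lin])
    show "\<exists>k::int. x \<bullet> x = 2 * of_int k" if "x \<in> ?S" for x
      using that even by (simp add: fixed_sublattice_def)
    show "real N *\<^sub>R w \<in> ?S" if w: "w \<in> lattice_dual ?S" for w
    proof -
      have "w \<in> span ?S" using w by (simp add: lattice_dual_def)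
      then have fw: "\<sigma> w = w" by (rule span_fixed)
      have "(real N *\<^sub>R w) \<bullet> x \<in> \<int>" if "x \<in> \<Lambda>" for x
      proof -
        have "w \<bullet> orbit_sum \<sigma> N x \<in> \<int>" using w tr[OF that] by (simp add: lattice_dual_def)
        then show ?thesis by (simp add: inner_orbit_sum[OF orth fw])
      qed
      then have "real N *\<^sub>R w \<in> lattice_dual \<Lambda>"
        by (simp add: lattice_dual_def full_lattice_span[OF full])
      then show ?thesis
        by (simp add: self_dual fixed_sublattice_def linear_cmul[OF lin] fw)
    qed
    show "\<exists>e\<in>?S. e \<noteq> 0"
    proof (rule ccontr)
      assume "\<not> ?thesis"
      then have "orbit_sum \<sigma> N x = 0" if "x \<in> \<Lambda>" for x using tr[OF that] by blast
      moreover have "v \<in> span \<Lambda>" using full_lattice_span[OF full] by simp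
      ultimately have "orbit_sum \<sigma> N v = 0"
        using linear_eq_0_on_span[OF linear_orbit_sum[OF lin]] by blast
      then show False
        using fixed prime_gt_0_nat[OF N] by (simp add: orbit_sum_of_fixed)
    qed
  qed
qed

section \<open>The simple roots of the fixed lattice\<close>

text \<open>The imaginary simple roots are multiples of the null vector \<open>\<rho>\<close>, so positive norm singles out
  the simple roots of the reflection group.\<close>
lemma real_simple_roots_gkm_G:
  "real_simple_roots (gkm_G N M L C) = {r \<in> simple_roots L C. lform r r > 0}"
proof -
  have null: "{n. n \<ge> 1 \<and> r = real n *\<^sub>R weyl_rho} = {}" if "lform r r > 0" for r
    using that by (auto simp: lform_simps lform_rho_rho)
  have "gkm_simple_mult (gkm_G N M L C) r > 0 \<longleftrightarrow> r \<in> simple_roots L C" if "lform r r > 0" for r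
    unfolding gkm_G_def gkm.simps null[OF that] by simp
  moreover have "gkm_form (gkm_G N M L C) = lform" by (simp add: gkm_G_def)
  ultimately show ?thesis unfolding real_simple_roots_def by (intro Collect_cong) auto
qed

theorem theorem5p1:
  fixes N M :: nat
    and \<Lambda> S :: "(real^24) set"
    and \<sigma> :: "real^24 \<Rightarrow> real^24"
    and L A B :: "lvec set"
  assumes "N \<in> {2, 3, 5, 7, 11, 23}"
    and "M = 24 div (N + 1)"
    and "leech_lattice \<Lambda>"
    and "lattice_automorphism \<Lambda> \<sigma>"
    and "has_order \<sigma> N"
    and "has_cycle_shape_1_N \<sigma> N M"
  defines "S \<equiv> fixed_sublattice \<sigma> \<Lambda>"
  defines "L \<equiv> lorentz_lattice S"
  defines "A \<equiv> {(l, 1, (l \<bullet> l) / 2 - 1) | l. l \<in> S}"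
  defines "B \<equiv> {(l, real N, (l \<bullet> l) / (2 * real N) - 1) | l.
                 l \<in> (\<lambda>v. real N *\<^sub>R v) ` lattice_dual S \<and>
                 (\<exists>k::int. (l \<bullet> l) / (2 * real N) - 1 = real N * of_int k)}"
  shows "{r. is_root L r \<and> lform r weyl_rho = - lform r r / 2} = A \<union> B \<and>
         (\<forall>C. weyl_chamber L C \<and> weyl_vector L C weyl_rho \<longrightarrow>
            simple_roots L C = A \<union> B \<and>
            real_simple_roots (gkm_G N M L C) = A \<union> B) \<and>
         (\<forall>r\<in>A. height r = 1 \<and> lform r r = 2) \<and>
         (\<forall>r\<in>B. height r = real N \<and> lform r r = 2 * real N)"
proof -
  have prime: "prime N" using assms(1) by auto
  have "M > 0" using assms(1,2) by auto
  have orth: "orthogonal_transformation \<sigma>" using assms(4) by (simp add: lattice_automorphism_def)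
  obtain v where v: "v \<noteq> 0" "\<sigma> v = v"
    by (rule cycle_shape_fixed_vector[OF orthogonal_transformation_linear[OF orth] assms(6) \<open>M > 0\<close>])
  interpret even_prime_level S N
    unfolding S_def
  proof (rule fixed_sublattice_even_prime_level[OF prime _ _ _ assms(4) _ v])
    show "full_lattice \<Lambda>" "lattice_dual \<Lambda> = \<Lambda>"
      using assms(3) by (simp_all add: leech_lattice_def)
    show "\<exists>k::int. x \<bullet> x = 2 * of_int k" if "x \<in> \<Lambda>" for x
      using assms(3) that by (simp add: leech_lattice_def)
    show "(\<sigma> ^^ N) = id" using assms(5) by (simp add: has_order_def)
  qed
  have A: "A = norm_2_family" and B: "B = norm_2N_family"
    by (simp_all add: A_def B_def norm_2_family_def norm_2N_family_def)
  have AB: "A \<union> B = weyl_roots" by (simp add: A B weyl_roots_eq)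
  have "{r. is_root L r \<and> lform r weyl_rho = - lform r r / 2} = A \<union> B"
    by (simp add: AB weyl_roots_def L_def)
  moreover have "simple_roots L C = A \<union> B \<and> real_simple_roots (gkm_G N M L C) = A \<union> B"
    if C: "weyl_chamber L C" "weyl_vector L C weyl_rho" for C
  proof -
    have eq: "simple_roots L C = A \<union> B"
      using simple_roots_eq_weyl_roots C by (simp add: AB L_def)
    moreover have "lform r r > 0" if "r \<in> A \<union> B" for r
      using that root_pos by (simp add: AB weyl_roots_def)
    ultimately show ?thesis by (simp add: real_simple_roots_gkm_G) blast
  qed
  moreover have "height r = 1 \<and> lform r r = 2" if "r \<in> A" for r
  proof -
    have rho: "lform r weyl_rho = - lform r r / 2"
      using that norm_2_family_subset by (auto simp: A weyl_roots_def)
    have "lform r weyl_rho = - 1"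
      using that unfolding A_def by (elim CollectE exE conjE) (simp add: lform_rho_Pair)
    with rho show ?thesis by (simp add: height_def lform_commute[of weyl_rho r])
  qed
  moreover have "height r = real N \<and> lform r r = 2 * real N" if "r \<in> B" for r
  proof -
    have rho: "lform r weyl_rho = - lform r r / 2"
      using that norm_2N_family_subset by (auto simp: B weyl_roots_def)
    have "lform r weyl_rho = - real N"
      using that unfolding B_def by (elim CollectE exE conjE) (simp add: lform_rho_Pair)
    with rho show ?thesis by (simp add: height_def lform_commute[of weyl_rho r])
  qed
  ultimately show ?thesis by simp
qed

end
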